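(* Let $r\ge1$ and $p\ge 1$ be integers, let $\beta_1,\dots,\beta_p$ be non-zero real numbers with $\sum_{i=1}^p\beta_i=1$, let $x\in\mathbb{R}^+$, and let $f$ belong to $C^{(r)}(\mathbb{R}^+)$ locally at $x$, that is, $f:\mathbb{R}^+\to\mathbb{R}$ is a bounded measurable function that is $r$ times continuously differentiable in a neighbourhood of $x$. Then, as $w\to+\infty$, $$(I_{w,p}^{\chi,\phi})(f,x)-f(x)=\sum_{j=1}^r\frac{(\theta^jf)(x)}{j!\,w^j}M_j^p(\chi,\phi)+o(w^{-r}),$$ where $$M_j^p(\chi,\phi)=\sum_{i=1}^p\frac{\beta_i}{i^j}\left(\sum_{\eta=0}^j\binom{j}{\eta}\hat m_{j-\eta}(\phi)\,m_\eta(\chi,x)\right).$$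
   Context: $\mathbb{R}^+=(0,\infty)$ carries the measure $d\mu=dt/t$. The kernels are a continuous function $\chi:\mathbb{R}^+\to\mathbb{R}$ and a function $\phi:\mathbb{R}^+\to\mathbb{R}$ with $\phi\in L^1(\mu)$. For $\nu\in\mathbb{N}_0$ put $$m_\nu(\chi,u)=\sum_{k\in\mathbb{Z}}\chi(e^{-k}u)(k-\log u)^\nu,\quad M_\nu(\chi)=\sup_{u\in\mathbb{R}^+}\sum_{k\in\mathbb{Z}}|\chi(e^{-k}u)||k-\log u|^\nu,$$ $$\hat m_\nu(\phi)=\int_0^\infty\phi(u)\log^\nu u\,\frac{du}{u},\quad \hat M_\nu(\phi)=\int_0^\infty|\phi(u)||\log u|^\nu\frac{du}{u}.$$ Standing assumptions on the kernels: (K1) for every $u\in\mathbb{R}^+$, $\sum_{k\in\mathbb{Z}}\chi(e^{-k}u)=1$, and $\int_0^\infty\phi(u)\frac{du}{u}=1$; (K2) for the given $r$, $M_r(\chi)+\hat M_r(\phi)<\infty$ and $\lim_{\gamma\to\infty}\sum_{|k-\log u|>\gamma}|\chi(e^{-k}u)||k-\log u|^r=0$ uniformly in $u\in\mathbb{R}^+$. For $w>0$ and $x\in\mathbb{R}^+$, $$(I_w^{\chi,\phi}f)(x)=\sum_{k\in\mathbb{Z}}\chi(e^{-k}x^w)\,w\int_0^\infty\phi(e^{-k}t^w)f(t)\frac{dt}{t},\qquad (I_{w,p}^{\chi,\phi})(f,x)=\sum_{i=1}^p\beta_i\,(I_{iw}^{\chi,\phi}f)(x).$$ The Mellin derivative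 is $\theta f(x)=xf'(x)$, with $\theta^1=\theta$ and $\theta^j=\theta(\theta^{j-1})$.
   Formalization: As printed the formula can fail, since m_η(χ,·) need not be constant; the formal theorem proves it with m_η(χ,x^{iw}) in the i-th summand, and with m_η(χ,x) when m_η(χ,x^w)=m_η(χ,x) for all w>0 and 1≤η≤r. *)

theory Defs
  imports "HOL-Analysis.Analysis" "HOL-Library.Landau_Symbols"
begin

text \<open>
  Functions on the positive reals are represented as functions on \<^typ>\<open>real\<close>; only their values
  on \<^term>\<open>{0<..} :: real set\<close> are ever used. Measurability is Lebesgue measurability.
\<close>

definition mellin_measure :: "real measure" where
  "mellin_measure = density (lebesgue_on {0<..}) (\<lambda>t. ennreal (1 / t))"

definition moment :: "nat \<Rightarrow> (real \<Rightarrow> real) \<Rightarrow> real \<Rightarrow> real" where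
  "moment \<nu> chi u = (\<Sum>\<^sub>\<infinity>k\<in>(UNIV::int set). chi (exp (- of_int k) * u) * (of_int k - ln u) ^ \<nu>)"

definition abs_moment :: "nat \<Rightarrow> (real \<Rightarrow> real) \<Rightarrow> ennreal" where
  "abs_moment \<nu> chi =
     (SUP u\<in>{0<..}. \<Sum>\<^sub>\<infinity>k\<in>(UNIV::int set). ennreal (\<bar>chi (exp (- of_int k) * u)\<bar> * \<bar>of_int k - ln u\<bar> ^ \<nu>))"

definition cont_moment :: "nat \<Rightarrow> (real \<Rightarrow> real) \<Rightarrow> real" where
  "cont_moment \<nu> phi = (\<integral>u. phi u * ln u ^ \<nu> \<partial>mellin_measure)"

definition abs_cont_moment :: "nat \<Rightarrow> (real \<Rightarrow> real) \<Rightarrow> ennreal" where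
  "abs_cont_moment \<nu> phi = (\<integral>\<^sup>+u. ennreal (\<bar>phi u\<bar> * \<bar>ln u\<bar> ^ \<nu>) \<partial>mellin_measure)"

definition durrmeyer_op ::
  "(real \<Rightarrow> real) \<Rightarrow> (real \<Rightarrow> real) \<Rightarrow> real \<Rightarrow> (real \<Rightarrow> real) \<Rightarrow> real \<Rightarrow> real" where
  "durrmeyer_op chi phi w f x =
     (\<Sum>\<^sub>\<infinity>k\<in>(UNIV::int set). chi (exp (- of_int k) * x powr w) *
        (w * (\<integral>t. phi (exp (- of_int k) * t powr w) * f t \<partial>mellin_measure)))"

definition durrmeyer_comb ::
  "(real \<Rightarrow> real) \<Rightarrow> (real \<Rightarrow> real) \<Rightarrow> (nat \<Rightarrow> real) \<Rightarrow> nat \<Rightarrow> real \<Rightarrow> (real \<Rightarrow> real) \<Rightarrow> real \<Rightarrow> real" where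
  "durrmeyer_comb chi phi \<beta> p w f x = (\<Sum>i=1..p. \<beta> i * durrmeyer_op chi phi (real i * w) f x)"

definition mellin_deriv :: "(real \<Rightarrow> real) \<Rightarrow> real \<Rightarrow> real" where
  "mellin_deriv f = (\<lambda>x. x * deriv f x)"

definition locally_C :: "nat \<Rightarrow> (real \<Rightarrow> real) \<Rightarrow> real \<Rightarrow> bool" where
  "locally_C r f x \<longleftrightarrow>
     bounded (f ` {0<..}) \<and> f \<in> borel_measurable (lebesgue_on {0<..}) \<and>
     (\<exists>U. open U \<and> x \<in> U \<and> U \<subseteq> {0<..} \<and>
        (\<forall>j<r. \<forall>y\<in>U. (deriv ^^ j) f differentiable (at y)) \<and>
        continuous_on U ((deriv ^^ r) f))"

text \<open>
  The constants \<open>M\<^sub>j\<^sup>p(chi, phi)\<close>, where the moments of \<open>chi\<close> in the \<open>i\<close>-th summand are evaluated at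
  \<^term>\<open>v i\<close>. The operator with parameter \<open>i w\<close> samples \<open>chi\<close> at \<open>e\<^sup>-\<^sup>k x\<^sup>i\<^sup>w\<close>, so the expansion produces
  the value \<open>v i = x\<^sup>i\<^sup>w\<close>; when the moments take the same value at all powers of \<open>x\<close>, this is the
  same as \<open>v i = x\<close>.
\<close>

definition comb_moment ::
  "(real \<Rightarrow> real) \<Rightarrow> (real \<Rightarrow> real) \<Rightarrow> (nat \<Rightarrow> real) \<Rightarrow> nat \<Rightarrow> nat \<Rightarrow> (nat \<Rightarrow> real) \<Rightarrow> real" where
  "comb_moment chi phi \<beta> p j v =
     (\<Sum>i=1..p. \<beta> i / real i ^ j *
        (\<Sum>\<eta>=0..j. real (j choose \<eta>) * cont_moment (j - \<eta>) phi * moment \<eta> chi (v i)))"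

end

theory Submission imports Defs begin

text \<open>
  In logarithmic coordinates the measure \<open>dt / t\<close> becomes Lebesgue measure and the Mellin derivative
  \<open>\<theta>\<close> becomes ordinary differentiation. With \<open>u = x\<^sup>w\<close> and \<open>a\<^sub>k = k - ln u\<close>, the operator reads
  \<open>\<Sum>\<^sub>k chi(e\<^sup>-\<^sup>k u) \<integral> phi(e\<^sup>v) f(x exp ((v + a\<^sub>k) / w)) dv\<close> (\<open>durrmeyer_op_log_coords\<close>).

  Now \<open>f (x e\<^sup>s)\<close> is replaced by its Taylor polynomial \<open>\<Sum>\<^sub>j (\<theta>\<^sup>j f)(x) s\<^sup>j / j!\<close> at \<open>s = (v + a\<^sub>k) / w\<close>.
  By the binomial theorem the monomial of degree \<open>j\<close> contributes exactly \<open>w\<^sup>-\<^sup>j\<close> times a sum of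
  products of moments of \<open>phi\<close> and of \<open>chi\<close> (\<open>shifted_cont_moment\<close>, \<open>has_sum_moment\<close>). No error arises
  here, provided that the moments of \<open>chi\<close> are taken at \<open>u\<close>.

  The Taylor remainder is at most \<open>\<epsilon> \<bar>s\<bar>\<^sup>r\<close> near \<open>s = 0\<close>, and at most \<open>H \<bar>s\<bar>\<^sup>r\<close> elsewhere because \<open>f\<close> is
  bounded (\<open>mellin_taylor_remainder_bound\<close>). For large \<open>w\<close>, the increment \<open>s\<close> can be far from \<open>0\<close> only
  if \<open>\<bar>a\<^sub>k\<bar>\<close> or \<open>\<bar>v\<bar>\<close> is large. The contribution of those points is a tail of the sum or of the
  integral, weighted with the powers of order \<open>r\<close>. The tails of the sum vanish uniformly in \<open>u\<close> by
  assumption, those of the integral by dominated convergence. So the total remainder is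
  \<open>o(w\<^sup>-\<^sup>r)\<close> (\<open>sampled_remainder_small\<close>). Uniformity in \<open>u\<close> is essential, since \<open>u = x\<^sup>w\<close> moves with \<open>w\<close>.

  The expansion of a combination follows by applying that of one operator
  (\<open>durrmeyer_op_expansion\<close>) to \<open>i w\<close> for each \<open>i\<close>.
\<close>

section \<open>Mellin integrals in logarithmic coordinates\<close>

lemma space_mellin_measure [simp]: "space mellin_measure = {0<..}"
  by (simp add: mellin_measure_def)

lemma borel_measurable_mellin_measure:
  "g \<in> borel_measurable mellin_measure \<longleftrightarrow> g \<in> borel_measurable (lebesgue_on {0<..})"
  by (simp add: mellin_measure_def cong: measurable_cong_sets)

text \<open>
  The change of variables theorem speaks of absolute integrability on a set, so the density of the
  Mellin measure has to be made explicit before it can be applied.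
\<close>

lemma mellin_measure_lebesgue:
  fixes G :: "real \<Rightarrow> real"
  shows "integrable mellin_measure G \<longleftrightarrow> (\<lambda>t. G t / t) absolutely_integrable_on {0<..}" (is ?A)
    and "integrable mellin_measure G \<Longrightarrow>
      (\<integral>t. G t \<partial>mellin_measure) = integral {0<..} (\<lambda>t. G t / t)" (is "_ \<Longrightarrow> ?B")
proof -
  have id: "(\<lambda>t::real. t) \<in> borel_measurable (lebesgue_on {0<..})"
    using id_borel_measurable_lebesgue_on by (simp add: id_def)
  then have inv: "(\<lambda>t::real. 1 / t) \<in> borel_measurable (lebesgue_on {0<..})"
    by measurable
  have pos: "AE t in lebesgue_on {0<..}. 0 \<le> 1 / (t::real)"
    by (rule AE_I2) simp
  have restr: "(\<lambda>t. G t / t) absolutely_integrable_on {0<..} \<longleftrightarrow> integrable (lebesgue_on {0<..}) (\<lambda>t. G t / t)"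
    by (simp add: set_integrable_def integrable_restrict_space)
  have eq: "integrable mellin_measure G \<longleftrightarrow> integrable (lebesgue_on {0<..}) (\<lambda>t. G t / t)"
  proof (cases "G \<in> borel_measurable (lebesgue_on {0<..})")
    case True
    then show ?thesis
      using integrable_density[OF True inv pos] by (simp add: mellin_measure_def)
  next
    case False
    have "\<not> integrable (lebesgue_on {0<..}) (\<lambda>t. G t / t)"
    proof
      assume "integrable (lebesgue_on {0<..}) (\<lambda>t. G t / t)"
      \<comment> \<open>Multiplying by \<open>t\<close>, which never vanishes on the half-line, recovers the measurability of \<open>G\<close>.\<close>
      then have "(\<lambda>t. t * (G t / t)) \<in> borel_measurable (lebesgue_on {0<..})"
        by (intro borel_measurable_times id borel_measurable_integrable)
      moreover have "(\<lambda>t. t * (G t / t)) \<in> borel_measurable (lebesgue_on {0<..})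
          \<longleftrightarrow> G \<in> borel_measurable (lebesgue_on {0<..})"
        by (rule measurable_cong) simp
      ultimately show False using False by simp
    qed
    moreover have "\<not> integrable mellin_measure G"
      using False borel_measurable_mellin_measure borel_measurable_integrable by blast
    ultimately show ?thesis by simp
  qed
  then show ?A using restr by simp
  show ?B if G: "integrable mellin_measure G"
  proof -
    have "G \<in> borel_measurable (lebesgue_on {0<..})"
      using G borel_measurable_mellin_measure borel_measurable_integrable by blast
    from integral_density[OF this inv pos]
    have "(\<integral>t. G t \<partial>mellin_measure) = (\<integral>t. G t / t \<partial>lebesgue_on {0<..})"
      by (simp add: mellin_measure_def)
    also have "\<dots> = integral {0<..} (\<lambda>t. G t / t)"
      using G eq by (intro lebesgue_integral_eq_integral) auto
    finally show ?thesis .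
  qed
qed

text \<open>
  The substitution \<open>t = exp ((v + c) / w)\<close> combines the passage to logarithmic coordinates with the
  dilation \<open>u = e\<^sup>-\<^sup>c t\<^sup>w\<close> inside the operator: the Jacobian \<open>t / w\<close> cancels the density \<open>1 / t\<close> up
  to the constant \<open>1 / w\<close>. As integrability is an equivalence, the lemma also serves to transfer
  integrability (hence measurability) between the two sides, for any function and any dilation.
\<close>

lemma mellin_integral_log_coords:
  fixes G :: "real \<Rightarrow> real" and w c :: real
  assumes "w > 0"
  shows "integrable mellin_measure G \<longleftrightarrow> integrable lebesgue (\<lambda>v. G (exp ((v + c) / w)))" (is ?A)
    and "w * (\<integral>t. G t \<partial>mellin_measure) = (\<integral>v. G (exp ((v + c) / w)) \<partial>lebesgue)" (is ?B)
proof -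
  define g where "g v = exp ((v + c) / w)" for v
  have "t \<in> range g" if "t > 0" for t
    using that assms by (intro range_eqI[of _ _ "w * ln t - c"]) (simp add: g_def)
  then have range: "range g = {0<..}"
    by (auto simp: g_def)
  have inj: "inj_on g UNIV"
    using assms by (auto simp: inj_on_def g_def)
  have deriv: "(g has_field_derivative g v / w) (at v within UNIV)" for v
    unfolding g_def using assms by (auto intro!: derivative_eq_intros)
  have jac: "\<bar>g v / w\<bar> * (G (g v) / g v) = G (g v) / w" for v
    using assms by (simp add: g_def)
  have cov: "(\<lambda>v. G (g v) / w) absolutely_integrable_on UNIV \<and> integral UNIV (\<lambda>v. G (g v) / w) = b
      \<longleftrightarrow> (\<lambda>t. G t / t) absolutely_integrable_on {0<..} \<and> integral {0<..} (\<lambda>t. G t / t) = b" for b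
    using has_absolute_integral_change_of_variables_1'[OF _ deriv inj, of "\<lambda>t. G t / t" b]
    by (simp only: jac range) simp
  have leb: "(\<lambda>v. G (g v) / w) absolutely_integrable_on UNIV \<longleftrightarrow> integrable lebesgue (\<lambda>v. G (g v))"
    using assms by (simp add: set_integrable_def divide_inverse)
  show A: ?A
    using cov[of "integral {0<..} (\<lambda>t. G t / t)"] cov[of "integral UNIV (\<lambda>v. G (g v) / w)"]
      leb mellin_measure_lebesgue(1)[of G] by (auto simp: g_def)
  show ?B
  proof (cases "integrable mellin_measure G")
    case True
    then have int: "integrable lebesgue (\<lambda>v. G (g v) / w)"
      using A by (simp add: g_def)
    have "(\<integral>t. G t \<partial>mellin_measure) = integral UNIV (\<lambda>v. G (g v) / w)"
      using True cov[of "integral {0<..} (\<lambda>t. G t / t)"] mellin_measure_lebesgue[of G] by auto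
    also have "\<dots> = (\<integral>v. G (g v) / w \<partial>lebesgue)"
      by (rule lebesgue_integral_eq_integral[of UNIV "\<lambda>v. G (g v) / w",
            unfolded lebesgue_on_UNIV_eq, OF int, symmetric]) simp
    finally show ?thesis
      using assms by (simp add: g_def)
  next
    case False
    then show ?thesis
      using A by (simp add: not_integrable_integral_eq)
  qed
qed

section \<open>Taylor expansion with Mellin derivatives\<close>

text \<open>
  The local smoothness of \<open>f\<close> is given through ordinary derivatives, while the expansion uses Mellin
  derivatives. Writing \<open>\<theta>\<^sup>j f\<close> as a combination of the functions \<open>y\<^sup>i f\<^sup>(\<^sup>i\<^sup>)(y)\<close> with \<open>i \<le> j\<close> (the
  coefficients are Stirling numbers of the second kind) transfers differentiability for \<open>j < r\<close> and
  continuity for \<open>j = r\<close>.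
\<close>

lemma mellin_deriv_funpow_expansion:
  fixes f :: "real \<Rightarrow> real"
  assumes "open U" and diff: "\<And>i y. i < r \<Longrightarrow> y \<in> U \<Longrightarrow> (deriv ^^ i) f differentiable (at y)"
    and "j \<le> r"
  shows "\<exists>c. \<forall>y\<in>U. (mellin_deriv ^^ j) f y = (\<Sum>i\<le>j. c i * (y ^ i * (deriv ^^ i) f y))"
  using \<open>j \<le> r\<close>
proof (induction j)
  case 0
  show ?case by (rule exI[of _ "\<lambda>_. 1"]) simp
next
  case (Suc j)
  then obtain c where c: "\<And>y. y \<in> U \<Longrightarrow>
      (mellin_deriv ^^ j) f y = (\<Sum>i\<le>j. c i * (y ^ i * (deriv ^^ i) f y))"
    by auto
  \<comment> \<open>\<open>\<theta> (y\<^sup>i f\<^sup>(\<^sup>i\<^sup>)) = i y\<^sup>i f\<^sup>(\<^sup>i\<^sup>) + y\<^sup>i\<^sup>+\<^sup>1 f\<^sup>(\<^sup>i\<^sup>+\<^sup>1\<^sup>)\<close>, read as the recursion of the Stirling numbers.\<close>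
  define c' where "c' i = (if i \<le> j then real i * c i else 0) + (if i = 0 then 0 else c (i - 1))" for i
  have "(mellin_deriv ^^ Suc j) f y = (\<Sum>i\<le>Suc j. c' i * (y ^ i * (deriv ^^ i) f y))" if y: "y \<in> U" for y
  proof -
    let ?F = "\<lambda>i. (deriv ^^ i) f"
    have D: "(?F i has_real_derivative ?F (Suc i) y) (at y)" if "i \<le> j" for i
      using diff[of i y] that y Suc.prems by (simp add: DERIV_deriv_iff_real_differentiable)
    have "((\<lambda>y. \<Sum>i\<le>j. c i * (y ^ i * ?F i y)) has_real_derivative
        (\<Sum>i\<le>j. c i * (real i * y ^ (i - 1) * ?F i y + y ^ i * ?F (Suc i) y))) (at y)"
    proof (rule DERIV_sum)
      fix i assume "i \<in> {..j}"
      then show "((\<lambda>y. c i * (y ^ i * ?F i y)) has_real_derivative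
          c i * (real i * y ^ (i - 1) * ?F i y + y ^ i * ?F (Suc i) y)) (at y)"
        using DERIV_cmult[OF DERIV_mult[OF DERIV_pow[of i y] D[of i]], of "c i"]
        by (simp add: mult.commute[of "y ^ i"] del: funpow.simps)
    qed
    moreover have "\<forall>\<^sub>F z in nhds y. (mellin_deriv ^^ j) f z = (\<Sum>i\<le>j. c i * (z ^ i * ?F i z))"
      using eventually_nhds_in_open[OF \<open>open U\<close> y] by eventually_elim (rule c)
    ultimately have "deriv ((mellin_deriv ^^ j) f) y =
        (\<Sum>i\<le>j. c i * (real i * y ^ (i - 1) * ?F i y + y ^ i * ?F (Suc i) y))"
      using deriv_cong_ev[OF _ refl, of "(mellin_deriv ^^ j) f"] DERIV_imp_deriv by simp
    then have "(mellin_deriv ^^ Suc j) f y =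
        y * (\<Sum>i\<le>j. c i * (real i * y ^ (i - 1) * ?F i y + y ^ i * ?F (Suc i) y))"
      by (simp add: mellin_deriv_def)
    also have "\<dots> = (\<Sum>i\<le>j. real i * c i * (y ^ i * ?F i y) + c i * (y ^ Suc i * ?F (Suc i) y))"
      unfolding sum_distrib_left
    proof (rule sum.cong[OF refl])
      fix i
      have "y * (real i * y ^ (i - 1)) = real i * y ^ i"
        by (cases i) auto
      then show "y * (c i * (real i * y ^ (i - 1) * ?F i y + y ^ i * ?F (Suc i) y)) =
          real i * c i * (y ^ i * ?F i y) + c i * (y ^ Suc i * ?F (Suc i) y)"
        by (simp add: algebra_simps) metis
    qed
    also have "\<dots> = (\<Sum>i\<le>j. real i * c i * (y ^ i * ?F i y))
        + (\<Sum>i\<le>j. c i * (y ^ Suc i * ?F (Suc i) y))"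
      by (rule sum.distrib)
    also have "(\<Sum>i\<le>j. real i * c i * (y ^ i * ?F i y)) =
        (\<Sum>i\<le>Suc j. (if i \<le> j then real i * c i else 0) * (y ^ i * ?F i y))"
      by simp
    also have "(\<Sum>i\<le>j. c i * (y ^ Suc i * ?F (Suc i) y)) =
        (\<Sum>i\<le>Suc j. (if i = 0 then 0 else c (i - 1)) * (y ^ i * ?F i y))"
      by (simp add: sum.atMost_Suc_shift del: sum.atMost_Suc funpow.simps)
    finally show ?thesis
      by (simp only: sum.distrib[symmetric] distrib_right[symmetric] c'_def)
  qed
  then show ?case by blast
qed

text \<open>
  Since \<open>d/ds (\<theta>\<^sup>j f)(x e\<^sup>s) = (\<theta>\<^sup>j\<^sup>+\<^sup>1 f)(x e\<^sup>s)\<close>, the Mellin derivatives at \<open>x\<close> are the ordinary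
  derivatives at \<open>0\<close> of \<open>s \<mapsto> f (x e\<^sup>s)\<close>. The Lagrange form of Taylor's theorem and the continuity of
  \<open>\<theta>\<^sup>r f\<close> at \<open>x\<close> give the remainder in Peano's form.
\<close>

lemma mellin_taylor_peano:
  assumes "x > 0" "r \<ge> 1" "locally_C r f x" "\<epsilon> > 0"
  shows "\<exists>\<delta>>0. \<forall>s. \<bar>s\<bar> \<le> \<delta> \<longrightarrow>
    \<bar>f (x * exp s) - (\<Sum>j\<le>r. (mellin_deriv ^^ j) f x / fact j * s ^ j)\<bar> \<le> \<epsilon> * \<bar>s\<bar> ^ r"
proof -
  let ?T = "\<lambda>j. (mellin_deriv ^^ j) f"
  obtain U where U: "open U" "x \<in> U" "U \<subseteq> {0<..}"
    and diff: "\<And>i y. i < r \<Longrightarrow> y \<in> U \<Longrightarrow> (deriv ^^ i) f differentiable (at y)"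
    and cont: "continuous_on U ((deriv ^^ r) f)"
    using assms(3) unfolding locally_C_def by blast
  have cont_i: "continuous_on U ((deriv ^^ i) f)" if "i \<le> r" for i
  proof (cases "i = r")
    case False
    then show ?thesis
      using diff[of i] that
      by (intro continuous_at_imp_continuous_on ballI differentiable_imp_continuous_within) auto
  qed (use cont in simp)
  have expansion: "\<exists>c. \<forall>y\<in>U. ?T j y = (\<Sum>i\<le>j. c i * (y ^ i * (deriv ^^ i) f y))" if "j \<le> r" for j
    using mellin_deriv_funpow_expansion[OF U(1) diff that] .
  have T_deriv: "(?T j has_real_derivative ?T (Suc j) y / y) (at y)" if j: "j < r" and y: "y \<in> U" for j y
  proof -
    obtain c where c: "\<And>y. y \<in> U \<Longrightarrow> ?T j y = (\<Sum>i\<le>j. c i * (y ^ i * (deriv ^^ i) f y))"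
      using expansion[of j] j by auto
    have "(\<lambda>y. \<Sum>i\<le>j. c i * (y ^ i * (deriv ^^ i) f y)) differentiable (at y)"
    proof (rule differentiable_sum, simp, rule ballI)
      show "(\<lambda>y. c i * (y ^ i * (deriv ^^ i) f y)) differentiable (at y)" if "i \<in> {..j}" for i
        using diff[of i y] j y that
        by (intro differentiable_mult differentiable_power differentiable_const differentiable_ident) auto
    qed
    moreover have ev: "\<forall>\<^sub>F z in nhds y. (\<Sum>i\<le>j. c i * (z ^ i * (deriv ^^ i) f z)) = ?T j z"
      using eventually_nhds_in_open[OF U(1) y] by eventually_elim (simp add: c)
    ultimately have "?T j differentiable (at y)"
      unfolding real_differentiable_def using DERIV_cong_ev[OF refl ev refl] by simp
    then show ?thesis
      using y U(3) by (auto simp: mellin_deriv_def DERIV_deriv_iff_real_differentiable)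
  qed
  have "continuous_on U (?T r)"
  proof -
    obtain c where c: "\<And>y. y \<in> U \<Longrightarrow> ?T r y = (\<Sum>i\<le>r. c i * (y ^ i * (deriv ^^ i) f y))"
      using expansion[of r] by auto
    have "continuous_on U (\<lambda>y. \<Sum>i\<le>r. c i * (y ^ i * (deriv ^^ i) f y))"
      by (intro continuous_intros cont_i) auto
    then show ?thesis
      using c by (simp cong: continuous_on_cong)
  qed
  then have "isCont (?T r) x"
    using U by (simp add: continuous_on_eq_continuous_at)
  moreover have "isCont (\<lambda>s. x * exp s) 0"
    by (intro continuous_intros)
  ultimately have "isCont (\<lambda>s. ?T r (x * exp s)) 0"
    by (intro isCont_o2[of 0 "\<lambda>s. x * exp s" "?T r"]) auto
  then have "((\<lambda>s. ?T r (x * exp s)) \<longlongrightarrow> ?T r (x * exp 0)) (nhds 0)"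
    unfolding isCont_def by (simp only: tendsto_at_iff_tendsto_nhds[of "\<lambda>s. ?T r (x * exp s)" 0])
  from tendstoD[OF this \<open>\<epsilon> > 0\<close>]
  have "\<forall>\<^sub>F s in nhds 0. dist (?T r (x * exp s)) (?T r x) < \<epsilon>" by simp
  moreover have "((\<lambda>s. x * exp s) \<longlongrightarrow> x * exp 0) (nhds 0)"
    using \<open>isCont (\<lambda>s. x * exp s) 0\<close> unfolding isCont_def
    by (simp only: tendsto_at_iff_tendsto_nhds[of "\<lambda>s. x * exp s" 0])
  from topological_tendstoD[OF this \<open>open U\<close>]
  have "\<forall>\<^sub>F s in nhds 0. x * exp s \<in> U" using \<open>x \<in> U\<close> by simp
  ultimately have "\<forall>\<^sub>F s in nhds 0. x * exp s \<in> U \<and> \<bar>?T r (x * exp s) - ?T r x\<bar> \<le> \<epsilon>"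
    by eventually_elim (simp add: dist_real_def)
  then obtain d where d: "d > 0"
    "\<And>s. \<bar>s\<bar> < d \<Longrightarrow> x * exp s \<in> U \<and> \<bar>?T r (x * exp s) - ?T r x\<bar> \<le> \<epsilon>"
    unfolding eventually_nhds_metric by (auto simp: dist_real_def)
  have "\<bar>f (x * exp s) - (\<Sum>j\<le>r. ?T j x / fact j * s ^ j)\<bar> \<le> \<epsilon> * \<bar>s\<bar> ^ r" if s: "\<bar>s\<bar> \<le> d / 2" for s
  proof (cases "s = 0")
    case True
    then show ?thesis
      using assms(2) by (simp add: sum.atMost_shift power_0_left)
  next
    case False
    have "\<forall>m t. m < r \<and> - (d/2) \<le> t \<and> t \<le> d/2 \<longrightarrow>
        ((\<lambda>s. ?T m (x * exp s)) has_real_derivative ?T (Suc m) (x * exp t)) (at t)"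
    proof (intro allI impI, elim conjE)
      fix m t assume mt: "m < r" "- (d/2) \<le> t" "t \<le> d/2"
      then have "x * exp t \<in> U" using d by (simp add: abs_le_iff)
      have "((\<lambda>s. x * exp s) has_real_derivative x * exp t) (at t)"
        by (auto intro!: derivative_eq_intros)
      from DERIV_chain2[where f = "?T m" and g = "\<lambda>s. x * exp s" and x = t and s = UNIV, OF T_deriv[OF mt(1) \<open>x * exp t \<in> U\<close>] this]
      show "((\<lambda>s. ?T m (x * exp s)) has_real_derivative ?T (Suc m) (x * exp t)) (at t)"
        using assms(1) by simp
    qed
    moreover have "- (d/2) \<le> s" "s \<le> d/2" using s by (simp_all add: abs_le_iff)
    ultimately have "\<exists>t. (if s < 0 then s < t \<and> t < 0 else 0 < t \<and> t < s) \<and>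
        f (x * exp s) = (\<Sum>m<r. ?T m (x * exp 0) / fact m * (s - 0) ^ m)
          + ?T r (x * exp t) / fact r * (s - 0) ^ r"
      using assms(2) d(1) False
      by (intro Taylor[where diff = "\<lambda>m s. ?T m (x * exp s)" and a = "- (d/2)" and b = "d/2"]) auto
    then obtain t where t: "if s < 0 then s < t \<and> t < 0 else 0 < t \<and> t < s"
      "f (x * exp s) = (\<Sum>m<r. ?T m x / fact m * s ^ m) + ?T r (x * exp t) / fact r * s ^ r"
      by auto
    have "\<bar>t\<bar> < d" using t(1) s d(1) by (auto split: if_splits)
    then have bound: "\<bar>?T r (x * exp t) - ?T r x\<bar> \<le> \<epsilon>" using d by blast
    have "f (x * exp s) - (\<Sum>j\<le>r. ?T j x / fact j * s ^ j) =
        (?T r (x * exp t) - ?T r x) / fact r * s ^ r"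
      unfolding t(2) lessThan_Suc_atMost[symmetric] by (simp add: algebra_simps diff_divide_distrib)
    also have "\<bar>\<dots>\<bar> = \<bar>?T r (x * exp t) - ?T r x\<bar> / fact r * \<bar>s\<bar> ^ r"
      by (simp add: abs_mult power_abs)
    also have "\<dots> \<le> \<epsilon> * \<bar>s\<bar> ^ r"
    proof (rule mult_right_mono)
      have "\<bar>?T r (x * exp t) - ?T r x\<bar> / fact r \<le> \<bar>?T r (x * exp t) - ?T r x\<bar> / 1"
        by (intro divide_left_mono) (auto simp: fact_ge_1)
      then show "\<bar>?T r (x * exp t) - ?T r x\<bar> / fact r \<le> \<epsilon>" using bound by simp
    qed simp
    finally show ?thesis .
  qed
  then show ?thesis
    using d(1) by (intro exI[of _ "d/2"]) auto
qed

text \<open>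
  Away from \<open>s = 0\<close> the remainder is a bounded function minus a polynomial of degree at most \<open>r\<close>, so a
  multiple of \<open>\<bar>s\<bar>\<^sup>r\<close> dominates it globally. Only the constant \<open>\<epsilon>\<close> near \<open>0\<close> is small; \<open>H\<close> depends on
  \<open>\<epsilon>\<close> through \<open>\<delta>\<close> and may be large.
\<close>

lemma mellin_taylor_remainder_bound:
  assumes "x > 0" "r \<ge> 1" "locally_C r f x" "\<epsilon> > 0"
  shows "\<exists>\<delta>>0. \<exists>H\<ge>0. \<forall>s.
    \<bar>f (x * exp s) - (\<Sum>j\<le>r. (mellin_deriv ^^ j) f x / fact j * s ^ j)\<bar>
      \<le> (if \<bar>s\<bar> \<le> \<delta> then \<epsilon> else H) * \<bar>s\<bar> ^ r"
proof -
  define d where "d j = (mellin_deriv ^^ j) f x / fact j" for j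
  obtain \<delta> where \<delta>: "\<delta> > 0"
    "\<And>s. \<bar>s\<bar> \<le> \<delta> \<Longrightarrow> \<bar>f (x * exp s) - (\<Sum>j\<le>r. d j * s ^ j)\<bar> \<le> \<epsilon> * \<bar>s\<bar> ^ r"
    using mellin_taylor_peano[OF assms] unfolding d_def by blast
  have "bounded (f ` {0<..})" using assms(3) by (simp add: locally_C_def)
  then obtain K where K: "\<And>t. t > 0 \<Longrightarrow> \<bar>f t\<bar> \<le> K"
    by (auto simp: bounded_iff)
  have "K \<ge> 0" using K[OF assms(1)] by linarith
  define H where "H = K / \<delta> ^ r + (\<Sum>j\<le>r. \<bar>d j\<bar> / \<delta> ^ (r - j))"
  have "\<bar>f (x * exp s) - (\<Sum>j\<le>r. d j * s ^ j)\<bar> \<le> H * \<bar>s\<bar> ^ r" if s: "\<bar>s\<bar> > \<delta>" for s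
  proof -
    have pow: "1 \<le> \<bar>s\<bar> ^ n / \<delta> ^ n" for n
      using s \<delta>(1) power_mono[of \<delta> "\<bar>s\<bar>" n] by simp
    have "\<bar>f (x * exp s)\<bar> \<le> K * (\<bar>s\<bar> ^ r / \<delta> ^ r)"
      using K[of "x * exp s"] assms(1) mult_left_mono[OF pow \<open>K \<ge> 0\<close>, of r] by simp
    moreover have "\<bar>\<Sum>j\<le>r. d j * s ^ j\<bar> \<le> (\<Sum>j\<le>r. \<bar>d j\<bar> / \<delta> ^ (r - j) * \<bar>s\<bar> ^ r)"
    proof (rule order_trans[OF sum_abs], rule sum_mono)
      fix j assume j: "j \<in> {..r}"
      have "\<bar>d j * s ^ j\<bar> = \<bar>d j\<bar> * \<bar>s\<bar> ^ j * 1"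
        by (simp add: abs_mult power_abs)
      also have "\<dots> \<le> \<bar>d j\<bar> * \<bar>s\<bar> ^ j * (\<bar>s\<bar> ^ (r - j) / \<delta> ^ (r - j))"
        by (intro mult_left_mono pow) auto
      also have "\<dots> = \<bar>d j\<bar> / \<delta> ^ (r - j) * (\<bar>s\<bar> ^ j * \<bar>s\<bar> ^ (r - j))"
        by simp
      also have "\<bar>s\<bar> ^ j * \<bar>s\<bar> ^ (r - j) = \<bar>s\<bar> ^ r"
        using j by (simp flip: power_add)
      finally show "\<bar>d j * s ^ j\<bar> \<le> \<bar>d j\<bar> / \<delta> ^ (r - j) * \<bar>s\<bar> ^ r" .
    qed
    ultimately show ?thesis
      by (simp add: H_def distrib_right sum_distrib_right)
  qed
  moreover have "H \<ge> 0"
    using \<open>K \<ge> 0\<close> \<delta>(1) by (auto simp: H_def intro!: add_nonneg_nonneg sum_nonneg)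
  ultimately have "\<bar>f (x * exp s) - (\<Sum>j\<le>r. d j * s ^ j)\<bar> \<le>
      (if \<bar>s\<bar> \<le> \<delta> then \<epsilon> else H) * \<bar>s\<bar> ^ r" for s
    using \<delta>(2)[of s] by simp
  with \<open>\<delta> > 0\<close> \<open>H \<ge> 0\<close> show ?thesis
    unfolding d_def by blast
qed

section \<open>Uniform control of the weighted kernels\<close>

text \<open>
  Extracts real inequalities for partial sums from a moment that is an extended nonnegative real.
\<close>

lemma infsum_ennreal_finite_sum_le:
  fixes f :: "'a \<Rightarrow> real"
  assumes "\<And>k. f k \<ge> 0" "finite F"
  shows "ennreal (sum f F) \<le> (\<Sum>\<^sub>\<infinity>k\<in>UNIV. ennreal (f k))"
proof -
  have "ennreal (sum f F) = (\<Sum>k\<in>F. ennreal (f k))"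
    using assms by (simp add: sum_ennreal)
  also have "\<dots> \<le> (\<Sum>\<^sub>\<infinity>k\<in>UNIV. ennreal (f k))"
    unfolding nonneg_infsum_complete[where f = "\<lambda>k. ennreal (f k)" and A = UNIV, simplified]
    using assms by (intro SUP_upper) auto
  finally show ?thesis .
qed

text \<open>
  The integers within distance one of \<open>ln u\<close> lie in a window of four, and there \<open>chi\<close> is evaluated on the
  compact set \<open>[e\<^sup>-\<^sup>1, e]\<close>, where continuity bounds it. All other terms have weight at most
  \<open>2 \<bar>k - ln u\<bar>\<^sup>r\<close> and are controlled by the absolute moment of order \<open>r\<close>. Hence this one moment
  controls all moments of lower order, uniformly in \<open>u\<close>. Finite partial sums express the bound and
  the summability together.
\<close>

lemma shifted_moment_bound:
  fixes chi :: "real \<Rightarrow> real"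
  assumes cont: "continuous_on {0<..} chi" and fin: "abs_moment r chi < \<infinity>"
  shows "\<exists>A\<ge>0. \<forall>u>0. \<forall>F. finite F \<longrightarrow>
    (\<Sum>k\<in>F. \<bar>chi (exp (- of_int k) * u)\<bar> * (1 + \<bar>of_int k - ln u\<bar> ^ r)) \<le> A"
proof -
  have "continuous_on {exp (- 1)..exp 1} chi"
    by (rule continuous_on_subset[OF cont])
       (use exp_gt_zero[of "- 1 :: real"] in \<open>auto simp del: exp_gt_zero\<close>)
  then have "bounded (chi ` {exp (- 1)..exp 1})"
    using compact_continuous_image compact_imp_bounded compact_Icc by blast
  then obtain C where C: "\<And>t. exp (- 1) \<le> t \<Longrightarrow> t \<le> exp 1 \<Longrightarrow> \<bar>chi t\<bar> \<le> C"
    unfolding bounded_iff by (metis atLeastAtMost_iff imageI real_norm_def)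
  have "C \<ge> 0" using C[of 1] by force
  define M where "M = enn2real (abs_moment r chi)"
  have "M \<ge> 0" by (simp add: M_def)
  have M: "(\<Sum>k\<in>F. \<bar>chi (exp (- of_int k) * u)\<bar> * \<bar>of_int k - ln u\<bar> ^ r) \<le> M"
    if "u > 0" "finite F" for u and F :: "int set"
  proof -
    let ?f = "\<lambda>k::int. \<bar>chi (exp (- of_int k) * u)\<bar> * \<bar>of_int k - ln u\<bar> ^ r"
    have "ennreal (sum ?f F) \<le> (\<Sum>\<^sub>\<infinity>k\<in>UNIV. ennreal (?f k))"
      by (rule infsum_ennreal_finite_sum_le) (use that in auto)
    also have "\<dots> \<le> abs_moment r chi"
      unfolding abs_moment_def using that by (intro SUP_upper) auto
    also have "\<dots> = ennreal M"
      using fin by (simp add: M_def)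
    finally show ?thesis using \<open>M \<ge> 0\<close> by simp
  qed
  have "(\<Sum>k\<in>F. \<bar>chi (exp (- of_int k) * u)\<bar> * (1 + \<bar>of_int k - ln u\<bar> ^ r)) \<le> 8 * C + 2 * M"
    if u: "u > 0" and F: "finite F" for u and F :: "int set"
  proof -
    let ?X = "\<lambda>k::int. \<bar>chi (exp (- of_int k) * u)\<bar>" and ?a = "\<lambda>k::int. \<bar>of_int k - ln u\<bar>"
    let ?J = "{\<lfloor>ln u\<rfloor> - 1..\<lfloor>ln u\<rfloor> + 2}"
    have "?X k * (1 + ?a k ^ r) \<le> 2 * C * indicator ?J k + 2 * (?X k * ?a k ^ r)" for k
    proof (cases "?a k \<le> 1")
      case True
      have "exp (- of_int k) * u = exp (ln u - of_int k)"
        using u by (simp add: exp_diff exp_minus field_simps)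
      then have "?X k \<le> C" using True by (auto intro!: C)
      moreover have "k \<in> ?J" using True by (simp add: abs_le_iff) linarith
      moreover have "?a k ^ r \<le> 1" using True by (simp add: power_le_one)
      ultimately have "?X k * (1 + ?a k ^ r) \<le> C * (1 + 1)"
        using \<open>C \<ge> 0\<close> by (intro mult_mono) auto
      then show ?thesis using \<open>k \<in> ?J\<close> by (simp add: add_increasing2)
    next
      case False
      then have "1 \<le> ?a k ^ r" by (simp add: one_le_power)
      then have "?X k * (1 + ?a k ^ r) \<le> ?X k * (2 * ?a k ^ r)"
        by (intro mult_left_mono) auto
      also have "\<dots> \<le> 2 * C * indicator ?J k + 2 * (?X k * ?a k ^ r)"
        using \<open>C \<ge> 0\<close> by simp
      finally show ?thesis .
    qed
    then have "(\<Sum>k\<in>F. ?X k * (1 + ?a k ^ r)) \<le>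
        (\<Sum>k\<in>F. 2 * C * indicator ?J k + 2 * (?X k * ?a k ^ r))"
      by (rule sum_mono)
    also have "\<dots> = 2 * C * (\<Sum>k\<in>F. indicator ?J k) + 2 * (\<Sum>k\<in>F. ?X k * ?a k ^ r)"
      by (simp add: sum.distrib sum_distrib_left)
    also have "(\<Sum>k\<in>F. indicator ?J k) = real (card (F \<inter> ?J))"
      using F by (simp add: indicator_def sum.If_cases Int_def)
    also have "2 * C * real (card (F \<inter> ?J)) + 2 * (\<Sum>k\<in>F. ?X k * ?a k ^ r) \<le> 2 * C * 4 + 2 * M"
    proof (intro add_mono mult_left_mono M u F)
      have "card (F \<inter> ?J) \<le> card ?J" by (intro card_mono) auto
      then show "real (card (F \<inter> ?J)) \<le> 4" by simp
    qed (use \<open>C \<ge> 0\<close> in auto)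
    finally show ?thesis by simp
  qed
  then show ?thesis
    using \<open>C \<ge> 0\<close> \<open>M \<ge> 0\<close> by (intro exI[of _ "8 * C + 2 * M"]) auto
qed

text \<open>
  For \<open>\<gamma> \<ge> 1\<close> the weights \<open>1 + \<bar>k - ln u\<bar>\<^sup>r\<close> and \<open>\<bar>k - ln u\<bar>\<^sup>r\<close> are comparable on the tail. The
  bound by \<open>A\<close> enters because a bound on an infinite sum says something about its partial sums only
  when the terms are summable.
\<close>

lemma shifted_moment_tail:
  fixes chi :: "real \<Rightarrow> real"
  assumes bound: "\<And>u F. u > 0 \<Longrightarrow> finite F \<Longrightarrow>
      (\<Sum>k\<in>F. \<bar>chi (exp (- of_int k) * u)\<bar> * (1 + \<bar>of_int k - ln u\<bar> ^ r)) \<le> A"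
    and lim: "uniform_limit {0<..}
      (\<lambda>\<gamma> u. \<Sum>\<^sub>\<infinity>k\<in>{k::int. \<bar>of_int k - ln u\<bar> > \<gamma>}.
         \<bar>chi (exp (- of_int k) * u)\<bar> * \<bar>of_int k - ln u\<bar> ^ r) (\<lambda>_. 0) at_top"
    and "\<epsilon> > 0"
  shows "\<forall>\<^sub>F \<gamma> in at_top. \<forall>u>0. \<forall>F. finite F \<longrightarrow>
    (\<Sum>k\<in>F. \<bar>chi (exp (- of_int k) * u)\<bar> * (1 + \<bar>of_int k - ln u\<bar> ^ r)
       * indicator {v. \<bar>v\<bar> > \<gamma>} (of_int k - ln u)) \<le> \<epsilon>"
proof -
  have "\<forall>\<^sub>F \<gamma> in at_top. \<forall>u\<in>{0<..}. dist (\<Sum>\<^sub>\<infinity>k\<in>{k::int. \<bar>of_int k - ln u\<bar> > \<gamma>}.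
         \<bar>chi (exp (- of_int k) * u)\<bar> * \<bar>of_int k - ln u\<bar> ^ r) 0 < \<epsilon> / 2"
    by (rule uniform_limitD[OF lim half_gt_zero[OF \<open>\<epsilon> > 0\<close>]])
  with eventually_ge_at_top[of 1] show ?thesis
  proof eventually_elim
    case (elim \<gamma>)
    show ?case
    proof (intro allI impI)
      fix u :: real and F :: "int set" assume u: "u > 0" and F: "finite F"
      let ?X = "\<lambda>k::int. \<bar>chi (exp (- of_int k) * u)\<bar>" and ?a = "\<lambda>k::int. \<bar>of_int k - ln u\<bar>"
      let ?S = "{k. ?a k > \<gamma>}"
      have "(\<lambda>k. ?X k * ?a k ^ r) summable_on ?S"
      proof (rule nonneg_bdd_above_summable_on, simp, rule bdd_aboveI2)
        fix G assume G: "G \<in> {G. G \<subseteq> ?S \<and> finite G}"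
        then have "(\<Sum>k\<in>G. ?X k * ?a k ^ r) \<le> (\<Sum>k\<in>G. ?X k * (1 + ?a k ^ r))"
          by (intro sum_mono mult_left_mono) auto
        also have "\<dots> \<le> A" using bound u G by blast
        finally show "(\<Sum>k\<in>G. ?X k * ?a k ^ r) \<le> A" .
      qed
      then have "(\<Sum>k\<in>F \<inter> ?S. ?X k * ?a k ^ r) \<le> (\<Sum>\<^sub>\<infinity>k\<in>?S. ?X k * ?a k ^ r)"
        using F by (intro finite_sum_le_infsum) auto
      also have "\<dots> \<le> \<epsilon> / 2"
        using elim(2) u by (force simp: dist_real_def)
      finally have half: "(\<Sum>k\<in>F \<inter> ?S. ?X k * ?a k ^ r) \<le> \<epsilon> / 2" .
      have "(\<Sum>k\<in>F. ?X k * (1 + ?a k ^ r) * indicator {v. \<bar>v\<bar> > \<gamma>} (of_int k - ln u)) =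
          (\<Sum>k\<in>F \<inter> ?S. ?X k * (1 + ?a k ^ r))"
        using F by (intro sum.mono_neutral_cong_right) auto
      also have "\<dots> \<le> (\<Sum>k\<in>F \<inter> ?S. ?X k * (2 * ?a k ^ r))"
        using elim(1) by (intro sum_mono mult_left_mono) (auto intro: one_le_power)
      also have "\<dots> = 2 * (\<Sum>k\<in>F \<inter> ?S. ?X k * ?a k ^ r)"
        by (simp add: sum_distrib_left algebra_simps)
      finally show "(\<Sum>k\<in>F. ?X k * (1 + ?a k ^ r) * indicator {v. \<bar>v\<bar> > \<gamma>} (of_int k - ln u)) \<le> \<epsilon>"
        using half by simp
    qed
  qed
qed

text \<open>
  The counterpart of the preceding lemma for the integral kernel, where integrability alone makes
  the tails vanish.
\<close>

lemma weighted_integral_tail: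
  fixes \<Phi> :: "real \<Rightarrow> real"
  assumes "integrable lebesgue (\<lambda>v. \<bar>\<Phi> v\<bar> * (1 + \<bar>v\<bar> ^ r))" "\<epsilon> > 0"
  shows "\<forall>\<^sub>F \<gamma> in at_top. (\<integral>v. \<bar>\<Phi> v\<bar> * (1 + \<bar>v\<bar> ^ r) * indicator {v. \<bar>v\<bar> > \<gamma>} v \<partial>lebesgue) \<le> \<epsilon>"
proof -
  let ?g = "\<lambda>v. \<bar>\<Phi> v\<bar> * (1 + \<bar>v\<bar> ^ r)"
  have sets: "{v::real. \<bar>v\<bar> > \<gamma>} \<in> sets lebesgue" for \<gamma>
  proof -
    have "{v::real. \<bar>v\<bar> > \<gamma>} \<in> sets borel" by measurable
    then show ?thesis by simp
  qed
  have "((\<lambda>\<gamma>. \<integral>v. ?g v * indicator {v. \<bar>v\<bar> > \<gamma>} v \<partial>lebesgue) \<longlongrightarrow> integral\<^sup>L lebesgue (\<lambda>v::real. 0)) at_top"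
  proof (rule integral_dominated_convergence_at_top[where w = ?g and f = "\<lambda>_. 0"])
    show "(\<lambda>v. ?g v * indicator {v. \<bar>v\<bar> > \<gamma>} v) \<in> borel_measurable lebesgue" for \<gamma>
      using sets assms(1)
      by (intro borel_measurable_times borel_measurable_indicator borel_measurable_integrable[OF assms(1)]) auto
    show "\<forall>\<^sub>F \<gamma> in at_top. AE v in lebesgue. norm (?g v * indicator {v. \<bar>v\<bar> > \<gamma>} v) \<le> ?g v"
      by (intro always_eventually allI AE_I2) (auto simp: indicator_def)
    show "AE v in lebesgue. ((\<lambda>\<gamma>. ?g v * indicator {v. \<bar>v\<bar> > \<gamma>} v) \<longlongrightarrow> 0) at_top"
    proof (rule AE_I2)
      fix v :: real
      have "\<forall>\<^sub>F \<gamma> in at_top. ?g v * indicator {v. \<bar>v\<bar> > \<gamma>} v = 0"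
        using eventually_ge_at_top[of "\<bar>v\<bar>"] by eventually_elim auto
      then show "((\<lambda>\<gamma>. ?g v * indicator {v. \<bar>v\<bar> > \<gamma>} v) \<longlongrightarrow> 0) at_top"
        by (rule tendsto_eventually)
    qed
  qed (use assms(1) in auto)
  then have "\<forall>\<^sub>F \<gamma> in at_top. dist (\<integral>v. ?g v * indicator {v. \<bar>v\<bar> > \<gamma>} v \<partial>lebesgue) 0 < \<epsilon>"
    using assms(2) tendstoD by fastforce
  then show ?thesis
    by eventually_elim (simp add: dist_real_def)
qed

section \<open>The contribution of the Taylor remainder\<close>

text \<open>
  The product form separates the variables: later \<open>a\<close> is the position of a sampling point, which is
  summed over, and \<open>b\<close> the variable of integration.
\<close>

lemma power_abs_add_le:
  fixes a b :: real
  shows "\<bar>a + b\<bar> ^ r \<le> 2 ^ r * ((1 + \<bar>a\<bar> ^ r) * (1 + \<bar>b\<bar> ^ r))"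
proof -
  have "\<bar>a + b\<bar> ^ r \<le> (2 * max \<bar>a\<bar> \<bar>b\<bar>) ^ r"
    by (rule power_mono) auto
  also have "\<dots> = 2 ^ r * max \<bar>a\<bar> \<bar>b\<bar> ^ r"
    by (rule power_mult_distrib)
  also have "max \<bar>a\<bar> \<bar>b\<bar> ^ r \<le> (1 + \<bar>a\<bar> ^ r) * (1 + \<bar>b\<bar> ^ r)"
    by (auto simp: max_def algebra_simps add_increasing add_increasing2)
  finally show ?thesis by simp
qed

text \<open>
  The analytic core: a function \<open>\<rho>\<close> with \<open>\<rho>(s) = o(s\<^sup>r)\<close> at \<open>0\<close> and \<open>\<rho>(s) = O(s\<^sup>r)\<close> globally
  contributes \<open>o(w\<^sup>-\<^sup>r)\<close> to the operator, uniformly in \<open>u\<close>. Write \<open>a = k - ln u\<close>. If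
  \<open>w \<ge> 2\<gamma> / \<delta>\<close> and \<open>\<bar>(v + a) / w\<bar> > \<delta>\<close>, then \<open>\<bar>v + a\<bar> > 2\<gamma>\<close>, so \<open>\<bar>a\<bar> > \<gamma>\<close> or \<open>\<bar>v\<bar> > \<gamma>\<close>. Hence the
  large constant \<open>H\<close> is only ever paired with a tail of the sum or with a tail of the integral, both
  of which \<open>\<gamma>\<close> makes small after \<open>H\<close> has been fixed.
\<close>

lemma sampled_remainder_small:
  fixes chi \<Phi> \<rho> :: "real \<Rightarrow> real"
  assumes "A \<ge> 0" and bound: "\<And>u F. u > 0 \<Longrightarrow> finite F \<Longrightarrow>
      (\<Sum>k\<in>F. \<bar>chi (exp (- of_int k) * u)\<bar> * (1 + \<bar>of_int k - ln u\<bar> ^ r)) \<le> A"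
    and tail: "\<And>\<epsilon>. \<epsilon> > 0 \<Longrightarrow> \<forall>\<^sub>F \<gamma> in at_top. \<forall>u>0. \<forall>F. finite F \<longrightarrow>
      (\<Sum>k\<in>F. \<bar>chi (exp (- of_int k) * u)\<bar> * (1 + \<bar>of_int k - ln u\<bar> ^ r)
         * indicator {v. \<bar>v\<bar> > \<gamma>} (of_int k - ln u)) \<le> \<epsilon>"
    and int: "integrable lebesgue (\<lambda>v. \<bar>\<Phi> v\<bar> * (1 + \<bar>v\<bar> ^ r))"
    and int_rem: "\<And>a w. w > 0 \<Longrightarrow> integrable lebesgue (\<lambda>v. \<Phi> v * \<rho> ((v + a) / w))"
    and rem: "\<And>\<epsilon>. \<epsilon> > 0 \<Longrightarrow>
      \<exists>\<delta>>0. \<exists>H\<ge>0. \<forall>s. \<bar>\<rho> s\<bar> \<le> (if \<bar>s\<bar> \<le> \<delta> then \<epsilon> else H) * \<bar>s\<bar> ^ r"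
    and "c > 0"
  shows "\<forall>\<^sub>F w in at_top. \<forall>u>0. \<forall>F. finite F \<longrightarrow>
    (\<Sum>k\<in>F. \<bar>chi (exp (- of_int k) * u) *
       (\<integral>v. \<Phi> v * \<rho> ((v + (of_int k - ln u)) / w) \<partial>lebesgue)\<bar>) \<le> c / w ^ r"
proof -
  let ?W = "\<lambda>v. \<bar>\<Phi> v\<bar> * (1 + \<bar>v\<bar> ^ r)"
  define N where "N = (\<integral>v. ?W v \<partial>lebesgue)"
  have "N \<ge> 0" by (simp add: N_def)
  \<comment> \<open>The final bound consists of three terms; \<open>\<epsilon>\<close>, \<open>\<tau>\<close> and \<open>T\<close> make each of them at most \<open>c / 3\<close>,
      where adding \<open>1\<close> keeps the denominators positive.\<close>
  define \<epsilon> where "\<epsilon> = c / (3 * 2 ^ r * (A * N + 1))"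
  have "\<epsilon> > 0" using \<open>A \<ge> 0\<close> \<open>N \<ge> 0\<close> \<open>c > 0\<close>
    by (auto simp: \<epsilon>_def intro!: divide_pos_pos mult_pos_pos add_nonneg_pos)
  from rem[OF this] obtain \<delta> H where "\<delta> > 0" "H \<ge> 0"
    and \<rho>: "\<And>s. \<bar>\<rho> s\<bar> \<le> (if \<bar>s\<bar> \<le> \<delta> then \<epsilon> else H) * \<bar>s\<bar> ^ r" by blast
  define \<tau> where "\<tau> = c / (3 * 2 ^ r * (A * H + 1))"
  define T where "T = c / (3 * 2 ^ r * (H * N + 1))"
  have "\<tau> > 0" "T > 0" using \<open>A \<ge> 0\<close> \<open>N \<ge> 0\<close> \<open>H \<ge> 0\<close> \<open>c > 0\<close>
    by (auto simp: \<tau>_def T_def intro!: divide_pos_pos mult_pos_pos add_nonneg_pos)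
  have third: "2 ^ r * (B * (c / (3 * 2 ^ r * (B + 1)))) \<le> c / 3" if "B \<ge> 0" for B :: real
  proof -
    have "2 ^ r * (B * (c / (3 * 2 ^ r * (B + 1)))) = c / 3 * (B / (B + 1))"
      using that by (simp add: divide_simps)
    also have "\<dots> \<le> c / 3 * 1"
      using that \<open>c > 0\<close> by (intro mult_left_mono) auto
    finally show ?thesis by simp
  qed
  have small: "2 ^ r * (A * (\<epsilon> * N + H * \<tau>) + H * N * T) \<le> c"
    using third[of "A * N"] third[of "A * H"] third[of "H * N"] \<open>A \<ge> 0\<close> \<open>N \<ge> 0\<close> \<open>H \<ge> 0\<close>
    unfolding \<epsilon>_def[symmetric] \<tau>_def[symmetric] T_def[symmetric]
    by (simp add: algebra_simps)
  obtain \<gamma> where "\<gamma> \<ge> 1"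
    and \<gamma>1: "(\<integral>v. ?W v * indicator {v. \<bar>v\<bar> > \<gamma>} v \<partial>lebesgue) \<le> \<tau>"
    and \<gamma>2: "\<And>u F. u > 0 \<Longrightarrow> finite F \<Longrightarrow>
      (\<Sum>k\<in>F. \<bar>chi (exp (- of_int k) * u)\<bar> * (1 + \<bar>of_int k - ln u\<bar> ^ r)
         * indicator {v. \<bar>v\<bar> > \<gamma>} (of_int k - ln u)) \<le> T"
    using eventually_happens[OF eventually_conj[OF eventually_ge_at_top[of 1]
        eventually_conj[OF weighted_integral_tail[OF int \<open>\<tau> > 0\<close>] tail[OF \<open>T > 0\<close>]]]]
    by auto
  let ?ind = "\<lambda>v. indicator {v. \<bar>v\<bar> > \<gamma>} v :: real"
  have int_tail: "integrable lebesgue (\<lambda>v. ?W v * ?ind v)"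
  proof -
    have "{v::real. \<bar>v\<bar> > \<gamma>} \<in> sets borel" by measurable
    then have "{v::real. \<bar>v\<bar> > \<gamma>} \<in> sets lebesgue" by simp
    from integrable_mult_indicator[OF this int] show ?thesis by (simp add: mult.commute)
  qed
  \<comment> \<open>The separated bound: near \<open>s = 0\<close> the factor \<open>\<epsilon>\<close> suffices, otherwise one of the two tails is active.\<close>
  have pointwise: "\<bar>\<rho> ((v + a) / w)\<bar> \<le>
      2 ^ r / w ^ r * (1 + \<bar>a\<bar> ^ r) * ((1 + \<bar>v\<bar> ^ r) * (\<epsilon> + H * ?ind a + H * ?ind v))"
    if w: "w \<ge> 2 * \<gamma> / \<delta>" "w > 0" for v a w
  proof -
    have "(if \<bar>(v + a) / w\<bar> \<le> \<delta> then \<epsilon> else H) \<le> \<epsilon> + H * ?ind a + H * ?ind v"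
    proof (cases "\<bar>(v + a) / w\<bar> \<le> \<delta>")
      case False
      have "2 * \<gamma> \<le> \<delta> * w" using w \<open>\<delta> > 0\<close> by (simp add: field_simps)
      also have "\<dots> < \<bar>v + a\<bar>" using False w by (simp add: field_simps)
      finally have "\<bar>a\<bar> > \<gamma> \<or> \<bar>v\<bar> > \<gamma>" by linarith
      then show ?thesis using False \<open>\<epsilon> > 0\<close> \<open>H \<ge> 0\<close> by (auto simp: indicator_def)
    qed (use \<open>H \<ge> 0\<close> in simp)
    then have "\<bar>\<rho> ((v + a) / w)\<bar> \<le> (\<epsilon> + H * ?ind a + H * ?ind v) * \<bar>(v + a) / w\<bar> ^ r"
      by (rule order_trans[OF \<rho> mult_right_mono]) simp
    also have "\<dots> \<le> (\<epsilon> + H * ?ind a + H * ?ind v) *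
        (2 ^ r / w ^ r * ((1 + \<bar>a\<bar> ^ r) * (1 + \<bar>v\<bar> ^ r)))"
    proof (rule mult_left_mono)
      have "\<bar>(v + a) / w\<bar> ^ r = \<bar>a + v\<bar> ^ r / w ^ r"
        using w by (simp add: power_divide add.commute)
      also have "\<dots> \<le> 2 ^ r * ((1 + \<bar>a\<bar> ^ r) * (1 + \<bar>v\<bar> ^ r)) / w ^ r"
        using w by (intro divide_right_mono power_abs_add_le) simp
      finally show "\<bar>(v + a) / w\<bar> ^ r \<le> 2 ^ r / w ^ r * ((1 + \<bar>a\<bar> ^ r) * (1 + \<bar>v\<bar> ^ r))"
        by simp
    qed (use \<open>\<epsilon> > 0\<close> \<open>H \<ge> 0\<close> in simp)
    finally show ?thesis
      by (simp only: mult_ac)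
  qed
  have single: "\<bar>\<integral>v. \<Phi> v * \<rho> ((v + a) / w) \<partial>lebesgue\<bar> \<le>
      2 ^ r / w ^ r * (1 + \<bar>a\<bar> ^ r) * ((\<epsilon> + H * ?ind a) * N + H * \<tau>)"
    if w: "w \<ge> 2 * \<gamma> / \<delta>" "w > 0" for a w
  proof -
    let ?K = "2 ^ r / w ^ r * (1 + \<bar>a\<bar> ^ r)"
    have "?K \<ge> 0" using w by simp
    have int_bound: "integrable lebesgue (\<lambda>v. ?K * ((\<epsilon> + H * ?ind a) * ?W v + H * (?W v * ?ind v)))"
      using int int_tail by (intro integrable_mult_right Bochner_Integration.integrable_add) auto
    have "\<bar>\<integral>v. \<Phi> v * \<rho> ((v + a) / w) \<partial>lebesgue\<bar> \<le>
        (\<integral>v. \<bar>\<Phi> v * \<rho> ((v + a) / w)\<bar> \<partial>lebesgue)"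
      by (rule integral_abs_bound)
    also have "\<dots> \<le> (\<integral>v. ?K * ((\<epsilon> + H * ?ind a) * ?W v + H * (?W v * ?ind v)) \<partial>lebesgue)"
    proof (rule integral_mono[OF integrable_abs[OF int_rem[OF w(2)]] int_bound])
      fix v
      have "\<bar>\<Phi> v * \<rho> ((v + a) / w)\<bar> \<le>
          \<bar>\<Phi> v\<bar> * (?K * ((1 + \<bar>v\<bar> ^ r) * (\<epsilon> + H * ?ind a + H * ?ind v)))"
        unfolding abs_mult using pointwise[OF w, of v a] by (intro mult_left_mono) auto
      also have "\<dots> = ?K * ((\<epsilon> + H * ?ind a) * ?W v + H * (?W v * ?ind v))"
        by (simp only: distrib_left distrib_right mult_ac add_ac)
      finally show "\<bar>\<Phi> v * \<rho> ((v + a) / w)\<bar> \<le>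
          ?K * ((\<epsilon> + H * ?ind a) * ?W v + H * (?W v * ?ind v))" .
    qed
    also have "\<dots> = ?K * ((\<epsilon> + H * ?ind a) * N + H * (\<integral>v. ?W v * ?ind v \<partial>lebesgue))"
      unfolding N_def using int int_tail by simp
    also have "\<dots> \<le> ?K * ((\<epsilon> + H * ?ind a) * N + H * \<tau>)"
      using \<gamma>1 \<open>H \<ge> 0\<close> \<open>?K \<ge> 0\<close> by (intro mult_left_mono add_left_mono) auto
    finally show ?thesis .
  qed
  have total: "(\<Sum>k\<in>F. \<bar>chi (exp (- of_int k) * u) *
       (\<integral>v. \<Phi> v * \<rho> ((v + (of_int k - ln u)) / w) \<partial>lebesgue)\<bar>) \<le> c / w ^ r"
    if w: "w \<ge> 2 * \<gamma> / \<delta>" "w > 0" and u: "u > 0" and F: "finite F" for w u and F :: "int set"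
  proof -
    let ?Y = "\<lambda>k. \<bar>chi (exp (- of_int k) * u)\<bar> * (1 + \<bar>of_int k - ln u\<bar> ^ r)"
    let ?i = "\<lambda>k. ?ind (of_int k - ln u)"
    have "(\<Sum>k\<in>F. \<bar>chi (exp (- of_int k) * u) *
           (\<integral>v. \<Phi> v * \<rho> ((v + (of_int k - ln u)) / w) \<partial>lebesgue)\<bar>)
        \<le> (\<Sum>k\<in>F. 2 ^ r / w ^ r * ((\<epsilon> * N + H * \<tau>) * ?Y k + H * N * (?Y k * ?i k)))"
    proof (rule sum_mono)
      fix k
      have "\<bar>chi (exp (- of_int k) * u) *
             (\<integral>v. \<Phi> v * \<rho> ((v + (of_int k - ln u)) / w) \<partial>lebesgue)\<bar>
          \<le> \<bar>chi (exp (- of_int k) * u)\<bar> *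
             (2 ^ r / w ^ r * (1 + \<bar>of_int k - ln u\<bar> ^ r) * ((\<epsilon> + H * ?i k) * N + H * \<tau>))"
        unfolding abs_mult by (intro mult_left_mono single w) auto
      also have "\<dots> = 2 ^ r / w ^ r * ((\<epsilon> * N + H * \<tau>) * ?Y k + H * N * (?Y k * ?i k))"
        by (simp only: distrib_left distrib_right mult_ac add_ac)
      finally show "\<bar>chi (exp (- of_int k) * u) *
             (\<integral>v. \<Phi> v * \<rho> ((v + (of_int k - ln u)) / w) \<partial>lebesgue)\<bar>
          \<le> 2 ^ r / w ^ r * ((\<epsilon> * N + H * \<tau>) * ?Y k + H * N * (?Y k * ?i k))" .
    qed
    also have "\<dots> = 2 ^ r / w ^ r *
        ((\<epsilon> * N + H * \<tau>) * (\<Sum>k\<in>F. ?Y k) + H * N * (\<Sum>k\<in>F. ?Y k * ?i k))"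
      by (simp only: sum_distrib_left[symmetric] sum.distrib)
    also have "\<dots> \<le> 2 ^ r / w ^ r * ((\<epsilon> * N + H * \<tau>) * A + H * N * T)"
      using w \<open>H \<ge> 0\<close> \<open>N \<ge> 0\<close> \<open>\<epsilon> > 0\<close> \<open>\<tau> > 0\<close>
      by (intro mult_left_mono add_mono bound \<gamma>2 u F) auto
    also have "\<dots> = 2 ^ r * (A * (\<epsilon> * N + H * \<tau>) + H * N * T) / w ^ r"
      by (simp add: mult.commute)
    also have "\<dots> \<le> c / w ^ r"
      using small w by (intro divide_right_mono) auto
    finally show ?thesis .
  qed
  show ?thesis
    using eventually_ge_at_top[of "2 * \<gamma> / \<delta>"] eventually_gt_at_top[of 0]
    by eventually_elim (use total in blast)
qed

section \<open>Moments of the two kernels\<close>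

text \<open>
  Lets the single weight \<open>1 + \<bar>v\<bar>\<^sup>r\<close> dominate every moment of order at most \<open>r\<close>.
\<close>

lemma power_le_one_plus_power:
  fixes v :: real
  assumes "j \<le> r"
  shows "\<bar>v\<bar> ^ j \<le> 1 + \<bar>v\<bar> ^ r"
proof (cases "\<bar>v\<bar> \<le> 1")
  case True
  then have "\<bar>v\<bar> ^ j \<le> 1" by (simp add: power_le_one)
  then show ?thesis by (simp add: add_increasing2)
next
  case False
  then have "\<bar>v\<bar> ^ j \<le> \<bar>v\<bar> ^ r" using assms by (intro power_increasing) auto
  then show ?thesis by simp
qed

lemma integrable_weighted_kernel:
  assumes phi: "integrable mellin_measure phi" and fin: "abs_cont_moment r phi < \<infinity>"
  shows "integrable lebesgue (\<lambda>v. \<bar>phi (exp v)\<bar> * (1 + \<bar>v\<bar> ^ r))"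
proof -
  have "(\<lambda>u::real. u) \<in> borel_measurable mellin_measure"
    using id_borel_measurable_lebesgue_on by (simp add: borel_measurable_mellin_measure id_def)
  then have "(\<lambda>u. \<bar>phi u\<bar> * \<bar>ln u\<bar> ^ r) \<in> borel_measurable mellin_measure"
    using borel_measurable_integrable[OF phi] by measurable
  then have "integrable mellin_measure (\<lambda>u. \<bar>phi u\<bar> * \<bar>ln u\<bar> ^ r)"
    using fin by (intro integrableI_nonneg) (auto simp: abs_cont_moment_def)
  then have "integrable mellin_measure (\<lambda>u. \<bar>phi u\<bar> + \<bar>phi u\<bar> * \<bar>ln u\<bar> ^ r)"
    using phi by (intro Bochner_Integration.integrable_add) auto
  then have "integrable mellin_measure (\<lambda>u. \<bar>phi u\<bar> * (1 + \<bar>ln u\<bar> ^ r))"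
    by (simp add: distrib_left)
  then show ?thesis
    using mellin_integral_log_coords(1)[of 1 "\<lambda>u. \<bar>phi u\<bar> * (1 + \<bar>ln u\<bar> ^ r)" 0] by simp
qed

lemma cont_moment_log_coords: "cont_moment j phi = (\<integral>v. phi (exp v) * v ^ j \<partial>lebesgue)"
  using mellin_integral_log_coords(2)[of 1 "\<lambda>u. phi u * ln u ^ j" 0]
  by (simp add: cont_moment_def)

lemma integrable_kernel_power:
  assumes phi: "integrable mellin_measure phi" and fin: "abs_cont_moment r phi < \<infinity>"
    and "j \<le> r"
  shows "integrable lebesgue (\<lambda>v. phi (exp v) * v ^ j)"
proof (rule Bochner_Integration.integrable_bound[OF integrable_weighted_kernel[OF phi fin]])
  have "integrable lebesgue (\<lambda>v. phi (exp v))"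
    using mellin_integral_log_coords(1)[of 1 phi 0] phi by simp
  then have [measurable]: "(\<lambda>v. phi (exp v)) \<in> borel_measurable lebesgue"
    by (rule borel_measurable_integrable)
  have [measurable]: "(\<lambda>v::real. v) \<in> borel_measurable lebesgue"
    using id_borel_measurable_lebesgue by (simp add: id_def)
  show "(\<lambda>v. phi (exp v) * v ^ j) \<in> borel_measurable lebesgue"
    by measurable
  show "AE v in lebesgue. norm (phi (exp v) * v ^ j) \<le> norm (\<bar>phi (exp v)\<bar> * (1 + \<bar>v\<bar> ^ r))"
    using power_le_one_plus_power[OF \<open>j \<le> r\<close>]
    by (intro AE_I2) (auto simp: abs_mult power_abs intro!: mult_left_mono)
qed

text \<open>
  The source of the inner sum in the asymptotic constants: integrating a shifted monomial against
  \<open>phi\<close> and expanding it binomially leaves powers of the shift \<open>a = k - ln u\<close>, which the discrete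
  kernel then turns into its own moments.
\<close>

lemma shifted_cont_moment:
  assumes "integrable mellin_measure phi" "abs_cont_moment r phi < \<infinity>" "j \<le> r"
  shows "integrable lebesgue (\<lambda>v. phi (exp v) * (v + a) ^ j)" (is ?A)
    and "(\<integral>v. phi (exp v) * (v + a) ^ j \<partial>lebesgue) =
      (\<Sum>\<eta>=0..j. real (j choose \<eta>) * cont_moment (j - \<eta>) phi * a ^ \<eta>)" (is ?B)
proof -
  have eq: "phi (exp v) * (v + a) ^ j =
      (\<Sum>\<eta>=0..j. real (j choose \<eta>) * a ^ \<eta> * (phi (exp v) * v ^ (j - \<eta>)))" for v
    by (simp add: add.commute[of v a] binomial_ring sum_distrib_left atLeast0AtMost mult_ac)
  have int: "integrable lebesgue (\<lambda>v. phi (exp v) * v ^ (j - \<eta>))" for \<eta>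
    using assms by (intro integrable_kernel_power[of _ r]) auto
  show ?A unfolding eq
    by (intro Bochner_Integration.integrable_sum integrable_mult_right int)
  have "(\<integral>v. phi (exp v) * (v + a) ^ j \<partial>lebesgue) =
      (\<Sum>\<eta>=0..j. real (j choose \<eta>) * a ^ \<eta> * cont_moment (j - \<eta>) phi)"
    unfolding eq cont_moment_log_coords
    by (subst Bochner_Integration.integral_sum) (simp_all add: int del: mult_eq_0_iff)
  then show ?B
    by (simp add: mult_ac)
qed

lemma has_sum_sum:
  fixes f :: "'i \<Rightarrow> 'a \<Rightarrow> 'b :: topological_comm_monoid_add"
  assumes "\<And>i. i \<in> I \<Longrightarrow> (f i has_sum s i) A"
  shows "((\<lambda>k. \<Sum>i\<in>I. f i k) has_sum (\<Sum>i\<in>I. s i)) A"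
  using assms
proof (induction I rule: infinite_finite_induct)
  case (insert i I)
  have "(f i has_sum s i) A" by (rule insert.prems) simp
  moreover have "((\<lambda>k. \<Sum>i\<in>I. f i k) has_sum (\<Sum>i\<in>I. s i)) A"
    by (rule insert.IH, rule insert.prems) simp
  ultimately have "((\<lambda>k. f i k + (\<Sum>i\<in>I. f i k)) has_sum s i + (\<Sum>i\<in>I. s i)) A"
    by (rule has_sum_add)
  then show ?case by (simp only: sum.insert[OF insert.hyps])
qed simp_all

lemma has_sum_moment:
  assumes bound: "\<And>F. finite F \<Longrightarrow>
      (\<Sum>k\<in>F. \<bar>chi (exp (- of_int k) * u)\<bar> * (1 + \<bar>of_int k - ln u\<bar> ^ r)) \<le> A"
    and "\<eta> \<le> r"
  shows "((\<lambda>k. chi (exp (- of_int k) * u) * (of_int k - ln u) ^ \<eta>) has_sum moment \<eta> chi u) UNIV"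
proof -
  have "(\<lambda>k. norm (chi (exp (- of_int k) * u) * (of_int k - ln u) ^ \<eta>)) summable_on UNIV"
  proof (rule nonneg_bdd_above_summable_on, simp, rule bdd_aboveI2)
    fix F :: "int set" assume F: "F \<in> {F. F \<subseteq> UNIV \<and> finite F}"
    have "(\<Sum>k\<in>F. norm (chi (exp (- of_int k) * u) * (of_int k - ln u) ^ \<eta>)) \<le>
        (\<Sum>k\<in>F. \<bar>chi (exp (- of_int k) * u)\<bar> * (1 + \<bar>of_int k - ln u\<bar> ^ r))"
      using power_le_one_plus_power[OF \<open>\<eta> \<le> r\<close>]
      by (intro sum_mono) (auto simp: abs_mult power_abs intro!: mult_left_mono)
    also have "\<dots> \<le> A" using bound F by blast
    finally show "(\<Sum>k\<in>F. norm (chi (exp (- of_int k) * u) * (of_int k - ln u) ^ \<eta>)) \<le> A" .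
  qed
  then show ?thesis
    unfolding moment_def by (rule has_sum_infsum[OF abs_summable_summable])
qed

section \<open>Asymptotic expansions\<close>

text \<open>
  With \<open>u = x\<^sup>w\<close> the argument of \<open>f\<close> becomes \<open>x\<close> times the exponential of \<open>(v + k - ln u) / w\<close>, which is
  the increment \<open>s\<close> of the Mellin-Taylor formula at \<open>x\<close>.
\<close>

lemma durrmeyer_op_log_coords:
  assumes "w > 0" "x > 0"
  shows "durrmeyer_op chi phi w f x =
    (\<Sum>\<^sub>\<infinity>k\<in>(UNIV::int set). chi (exp (- of_int k) * x powr w) *
       (\<integral>v. phi (exp v) * f (x * exp ((v + (of_int k - ln (x powr w))) / w)) \<partial>lebesgue))"
proof -
  have "w * (\<integral>t. phi (exp (- of_int k) * t powr w) * f t \<partial>mellin_measure) =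
      (\<integral>v. phi (exp v) * f (x * exp ((v + (of_int k - ln (x powr w))) / w)) \<partial>lebesgue)" for k :: int
  proof -
    have arg: "x * exp ((v + (of_int k - ln (x powr w))) / w) = exp ((v + of_int k) / w)" for v
    proof -
      have "(v + (of_int k - ln (x powr w))) / w = (v + of_int k) / w - ln x"
        using assms by (simp add: ln_powr field_simps)
      then show ?thesis using assms by (simp add: exp_diff)
    qed
    have "exp (- of_int k) * exp ((v + of_int k) / w) powr w = exp v" for v
      using assms by (simp add: powr_def flip: exp_add)
    then show ?thesis
      by (simp only: arg mellin_integral_log_coords(2)[OF assms(1), where c = "of_int k"])
  qed
  then show ?thesis
    by (simp add: durrmeyer_op_def)
qed

text \<open>
  A composition of Lebesgue measurable functions may fail to be measurable, so the composition of
  \<open>f\<close> with the substitution is not treated on its own. Instead the substitution is undone on \<open>phi\<close>,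
  the product with \<open>f\<close> is formed where \<open>f\<close> is known to be measurable, and the product is substituted
  back as one integrable function.
\<close>

lemma integrable_kernel_times_bounded:
  fixes phi f :: "real \<Rightarrow> real"
  assumes phi: "integrable mellin_measure phi" and bdd: "bounded (f ` {0<..})"
    and meas: "f \<in> borel_measurable (lebesgue_on {0<..})" and "w > 0" "x > 0"
  shows "integrable lebesgue (\<lambda>v. phi (exp v) * f (x * exp ((v + a) / w)))"
proof -
  define c where "c = a + w * ln x"
  have arg: "x * exp ((v + a) / w) = exp ((v + c) / w)" for v
  proof -
    have "(v + c) / w = (v + a) / w + ln x"
      using assms by (simp add: c_def field_simps)
    then show ?thesis using assms by (simp add: exp_add)
  qed
  have dil: "phi (exp (- c) * exp ((v + c) / w) powr w) = phi (exp v)" for v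
    using assms by (simp add: powr_def flip: exp_add)
  have "integrable lebesgue (\<lambda>v. phi (exp v))"
    using mellin_integral_log_coords(1)[of 1 phi 0] phi by simp
  then have dilated: "integrable mellin_measure (\<lambda>t. phi (exp (- c) * t powr w))"
    unfolding mellin_integral_log_coords(1)[OF \<open>w > 0\<close>, where c = c] dil .
  obtain K where K: "\<And>t. t > 0 \<Longrightarrow> \<bar>f t\<bar> \<le> K"
    using bdd by (auto simp: bounded_iff)
  have "integrable mellin_measure (\<lambda>t. phi (exp (- c) * t powr w) * f t)"
  proof (rule Bochner_Integration.integrable_bound)
    show "integrable mellin_measure (\<lambda>t. phi (exp (- c) * t powr w) * K)"
      using dilated by simp
    show "(\<lambda>t. phi (exp (- c) * t powr w) * f t) \<in> borel_measurable mellin_measure"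
      using dilated meas
      by (intro borel_measurable_times) (auto simp: borel_measurable_mellin_measure)
    show "AE t in mellin_measure. norm (phi (exp (- c) * t powr w) * f t)
        \<le> norm (phi (exp (- c) * t powr w) * K)"
    proof (rule AE_I2)
      fix t assume "t \<in> space mellin_measure"
      then have "\<bar>f t\<bar> \<le> \<bar>K\<bar>" using K[of t] by simp
      then show "norm (phi (exp (- c) * t powr w) * f t) \<le> norm (phi (exp (- c) * t powr w) * K)"
        by (simp add: abs_mult mult_left_mono)
    qed
  qed
  then show ?thesis
    unfolding mellin_integral_log_coords(1)[OF \<open>w > 0\<close>, where c = c] dil arg .
qed

text \<open>
  The Taylor polynomial of degree \<open>r\<close> contributes exactly \<open>f x\<close> and the terms of the sum, and the
  remainder is negligible. The moments of \<open>chi\<close> are taken at \<open>x\<^sup>w\<close>, the point at which the operator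
  samples.
\<close>

lemma durrmeyer_op_expansion:
  fixes chi phi f :: "real \<Rightarrow> real" and r :: nat and x :: real
  assumes cont: "continuous_on {0<..} chi"
    and phi: "integrable mellin_measure phi"
    and K1_chi: "\<And>u. u > 0 \<Longrightarrow> moment 0 chi u = 1"
    and K1_phi: "cont_moment 0 phi = 1"
    and fin: "abs_moment r chi < \<infinity>" "abs_cont_moment r phi < \<infinity>"
    and lim: "uniform_limit {0<..}
      (\<lambda>\<gamma> u. \<Sum>\<^sub>\<infinity>k\<in>{k::int. \<bar>of_int k - ln u\<bar> > \<gamma>}.
         \<bar>chi (exp (- of_int k) * u)\<bar> * \<bar>of_int k - ln u\<bar> ^ r) (\<lambda>_. 0) at_top"
    and "r \<ge> 1" "x > 0" and f: "locally_C r f x"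
  shows "(\<lambda>w. durrmeyer_op chi phi w f x - f x
      - (\<Sum>j=1..r. (mellin_deriv ^^ j) f x / (fact j * w ^ j)
          * (\<Sum>\<eta>=0..j. real (j choose \<eta>) * cont_moment (j - \<eta>) phi * moment \<eta> chi (x powr w))))
    \<in> o[at_top](\<lambda>w. 1 / w ^ r)"
proof -
  define \<Phi> where "\<Phi> v = phi (exp v)" for v
  define d where "d j = (mellin_deriv ^^ j) f x / fact j" for j
  define \<rho> where "\<rho> s = f (x * exp s) - (\<Sum>j\<le>r. d j * s ^ j)" for s
  define Q where "Q j u = (\<Sum>\<eta>=0..j. real (j choose \<eta>) * cont_moment (j - \<eta>) phi * moment \<eta> chi u)" for j u
  define S where "S w = durrmeyer_op chi phi w f x - f x
      - (\<Sum>j=1..r. (mellin_deriv ^^ j) f x / (fact j * w ^ j) * Q j (x powr w))" for w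
  obtain A where "A \<ge> 0" and A: "\<And>u F. u > 0 \<Longrightarrow> finite F \<Longrightarrow>
      (\<Sum>k\<in>F. \<bar>chi (exp (- of_int k) * u)\<bar> * (1 + \<bar>of_int k - ln u\<bar> ^ r)) \<le> A"
    using shifted_moment_bound[OF cont fin(1)] by blast
  have int_f: "integrable lebesgue (\<lambda>v. \<Phi> v * f (x * exp ((v + a) / w)))" if "w > 0" for a w
    using integrable_kernel_times_bounded[OF phi _ _ that \<open>x > 0\<close>] f
    by (auto simp: locally_C_def \<Phi>_def)
  have int_pow: "integrable lebesgue (\<lambda>v. \<Phi> v * (v + a) ^ j)" if "j \<le> r" for a j
    using shifted_cont_moment(1)[OF phi fin(2) that] by (simp add: \<Phi>_def)
  have split_rem: "\<Phi> v * \<rho> ((v + a) / w) = \<Phi> v * f (x * exp ((v + a) / w))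
      - (\<Sum>j\<le>r. d j / w ^ j * (\<Phi> v * (v + a) ^ j))" for v a w
    by (simp add: \<rho>_def right_diff_distrib sum_distrib_left power_divide mult_ac)
  have int_rem: "integrable lebesgue (\<lambda>v. \<Phi> v * \<rho> ((v + a) / w))" if "w > 0" for a w
    unfolding split_rem
    using int_f[OF that] int_pow
    by (intro Bochner_Integration.integrable_diff Bochner_Integration.integrable_sum
        integrable_mult_right) auto
  have rem: "\<exists>\<delta>>0. \<exists>H\<ge>0. \<forall>s. \<bar>\<rho> s\<bar> \<le> (if \<bar>s\<bar> \<le> \<delta> then \<epsilon> else H) * \<bar>s\<bar> ^ r" if "\<epsilon> > 0" for \<epsilon>
    using mellin_taylor_remainder_bound[OF \<open>x > 0\<close> \<open>r \<ge> 1\<close> f that] by (simp add: \<rho>_def d_def)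
  have int_W: "integrable lebesgue (\<lambda>v. \<bar>\<Phi> v\<bar> * (1 + \<bar>v\<bar> ^ r))"
    using integrable_weighted_kernel[OF phi fin(2)] by (simp add: \<Phi>_def)
  have tail: "\<forall>\<^sub>F \<gamma> in at_top. \<forall>u>0. \<forall>F. finite F \<longrightarrow>
      (\<Sum>k\<in>F. \<bar>chi (exp (- of_int k) * u)\<bar> * (1 + \<bar>of_int k - ln u\<bar> ^ r)
         * indicator {v. \<bar>v\<bar> > \<gamma>} (of_int k - ln u)) \<le> \<epsilon>" if "\<epsilon> > 0" for \<epsilon>
    by (rule shifted_moment_tail[OF _ lim that]) (rule A)
  have small: "\<forall>\<^sub>F w in at_top. \<forall>u>0. \<forall>F. finite F \<longrightarrow>
      (\<Sum>k\<in>F. \<bar>chi (exp (- of_int k) * u) *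
         (\<integral>v. \<Phi> v * \<rho> ((v + (of_int k - ln u)) / w) \<partial>lebesgue)\<bar>) \<le> c / w ^ r" if "c > 0" for c
    by (rule sampled_remainder_small[where A = A]) fact+
  have "\<forall>\<^sub>F w in at_top. norm (S w) \<le> c * norm (1 / w ^ r)" if "c > 0" for c
    using small[OF that] eventually_gt_at_top[of 0]
  proof eventually_elim
    case (elim w)
    define u where "u = x powr w"
    have "u > 0" using \<open>x > 0\<close> by (simp add: u_def)
    let ?X = "\<lambda>k::int. chi (exp (- of_int k) * u)" and ?a = "\<lambda>k::int. of_int k - ln u"
    let ?R = "\<lambda>k. ?X k * (\<integral>v. \<Phi> v * \<rho> ((v + ?a k) / w) \<partial>lebesgue)"
    have R: "(\<Sum>k\<in>F. \<bar>?R k\<bar>) \<le> c / w ^ r" if "finite F" for F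
      using elim(1) that \<open>u > 0\<close> by blast
    have "(\<lambda>k. norm (?R k)) summable_on UNIV"
      by (rule nonneg_bdd_above_summable_on, simp, rule bdd_aboveI2[where M = "c / w ^ r"])
         (simp add: R)
    note R_summable = this
    have R_sum: "(?R has_sum infsum ?R UNIV) UNIV"
      by (rule has_sum_infsum[OF abs_summable_summable[OF R_summable]])
    have "norm (infsum ?R UNIV) \<le> (\<Sum>\<^sub>\<infinity>k. norm (?R k))"
      by (rule norm_infsum_bound[OF R_summable])
    also have "\<dots> \<le> c / w ^ r"
      by (rule infsum_le_finite_sums[OF R_summable]) (simp add: R)
    finally have R_le: "\<bar>infsum ?R UNIV\<bar> \<le> c / w ^ r" by simp
    define e where "e = infsum ?R UNIV"
    note e = R_sum[folded e_def] R_le[folded e_def]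
    have Q: "((\<lambda>k. ?X k * (\<integral>v. \<Phi> v * (v + ?a k) ^ j \<partial>lebesgue)) has_sum Q j u) UNIV" if "j \<le> r" for j
    proof -
      have "((\<lambda>k. \<Sum>\<eta>=0..j. real (j choose \<eta>) * cont_moment (j - \<eta>) phi * (?X k * ?a k ^ \<eta>))
          has_sum Q j u) UNIV"
        unfolding Q_def using A \<open>u > 0\<close> that
        by (intro has_sum_sum has_sum_cmult_right has_sum_moment[of _ _ r A]) auto
      moreover have "?X k * (\<integral>v. \<Phi> v * (v + ?a k) ^ j \<partial>lebesgue) =
          (\<Sum>\<eta>=0..j. real (j choose \<eta>) * cont_moment (j - \<eta>) phi * (?X k * ?a k ^ \<eta>))" for k
        unfolding \<Phi>_def shifted_cont_moment(2)[OF phi fin(2) that] sum_distrib_left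
        by (simp add: mult_ac)
      ultimately show ?thesis by simp
    qed
    \<comment> \<open>Each summand of the operator is a remainder term plus \<open>r + 1\<close> moment terms, all of them summable over \<open>k\<close>.\<close>
    have term_eq: "?X k * (\<integral>v. \<Phi> v * f (x * exp ((v + ?a k) / w)) \<partial>lebesgue) =
        ?R k + (\<Sum>j\<le>r. d j / w ^ j * (?X k * (\<integral>v. \<Phi> v * (v + ?a k) ^ j \<partial>lebesgue)))" for k
    proof -
      have "(\<integral>v. \<Phi> v * \<rho> ((v + ?a k) / w) \<partial>lebesgue) =
          (\<integral>v. \<Phi> v * f (x * exp ((v + ?a k) / w)) \<partial>lebesgue)
          - (\<Sum>j\<le>r. d j / w ^ j * (\<integral>v. \<Phi> v * (v + ?a k) ^ j \<partial>lebesgue))"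
        unfolding split_rem using int_f[OF elim(2)] int_pow
        by (subst Bochner_Integration.integral_diff)
           (auto intro!: Bochner_Integration.integrable_sum simp: Bochner_Integration.integral_sum)
      then show ?thesis by (simp add: right_diff_distrib sum_distrib_left mult_ac)
    qed
    have "((\<lambda>k. ?X k * (\<integral>v. \<Phi> v * f (x * exp ((v + ?a k) / w)) \<partial>lebesgue))
        has_sum (e + (\<Sum>j\<le>r. d j / w ^ j * Q j u))) UNIV"
      unfolding term_eq by (intro has_sum_add e has_sum_sum has_sum_cmult_right Q) auto
    then have "durrmeyer_op chi phi w f x = e + (\<Sum>j\<le>r. d j / w ^ j * Q j u)"
      unfolding durrmeyer_op_log_coords[OF elim(2) \<open>x > 0\<close>] \<Phi>_def[symmetric] u_def[symmetric]
      by (rule infsumI)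
    also have "(\<Sum>j\<le>r. d j / w ^ j * Q j u) = d 0 * Q 0 u + (\<Sum>j=1..r. d j / w ^ j * Q j u)"
      by (simp add: atMost_atLeast0 sum.atLeast_Suc_atMost)
    \<comment> \<open>The normalisation of both kernels makes the term of order zero equal to \<open>f x\<close>.\<close>
    also have "d 0 * Q 0 u = f x"
      using K1_chi[OF \<open>u > 0\<close>] K1_phi by (simp add: d_def Q_def)
    finally have "S w = e"
      by (simp add: S_def d_def u_def)
    then show ?case using e(2) elim(2) by simp
  qed
  then show ?thesis
    unfolding S_def Q_def by (rule landau_o.smallI)
qed

theorem theorem5p1:
  fixes chi phi f :: "real \<Rightarrow> real" and \<beta> :: "nat \<Rightarrow> real" and r p :: nat and x :: real
  assumes "continuous_on {0<..} chi"
    and "integrable mellin_measure phi"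
    and K1_chi: "\<And>u. u > 0 \<Longrightarrow> (\<Sum>\<^sub>\<infinity>k\<in>(UNIV::int set). chi (exp (- of_int k) * u)) = 1"
    and K1_phi: "(\<integral>u. phi u \<partial>mellin_measure) = 1"
    and K2_fin: "abs_moment r chi + abs_cont_moment r phi < \<infinity>"
    and K2_lim: "uniform_limit {0<..}
      (\<lambda>\<gamma> u. \<Sum>\<^sub>\<infinity>k\<in>{k::int. \<bar>of_int k - ln u\<bar> > \<gamma>}.
         \<bar>chi (exp (- of_int k) * u)\<bar> * \<bar>of_int k - ln u\<bar> ^ r) (\<lambda>_. 0) at_top"
    and "r \<ge> 1" and "p \<ge> 1"
    and "\<And>i. i \<in> {1..p} \<Longrightarrow> \<beta> i \<noteq> 0" and "(\<Sum>i=1..p. \<beta> i) = 1"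
    and "x > 0" and "locally_C r f x"
  shows "(\<lambda>w. durrmeyer_comb chi phi \<beta> p w f x - f x
            - (\<Sum>j=1..r. (mellin_deriv ^^ j) f x / (fact j * w ^ j)
                 * comb_moment chi phi \<beta> p j (\<lambda>i. x powr (real i * w))))
          \<in> o[at_top](\<lambda>w. 1 / w ^ r)
       \<and> ((\<forall>\<eta>\<in>{1..r}. \<forall>w>0. moment \<eta> chi (x powr w) = moment \<eta> chi x) \<longrightarrow>
          (\<lambda>w. durrmeyer_comb chi phi \<beta> p w f x - f x
            - (\<Sum>j=1..r. (mellin_deriv ^^ j) f x / (fact j * w ^ j)
                 * comb_moment chi phi \<beta> p j (\<lambda>i. x)))
          \<in> o[at_top](\<lambda>w. 1 / w ^ r))"
proof -
  have moment0: "moment 0 chi u = 1" if "u > 0" for u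
    using K1_chi[OF that] by (simp add: moment_def)
  define Q where "Q j u = (\<Sum>\<eta>=0..j. real (j choose \<eta>) * cont_moment (j - \<eta>) phi * moment \<eta> chi u)" for j u
  have comb_moment_Q: "comb_moment chi phi \<beta> p j v = (\<Sum>i=1..p. \<beta> i / real i ^ j * Q j (v i))" for j v
    by (simp only: comb_moment_def Q_def)
  define S where "S w = durrmeyer_op chi phi w f x - f x
      - (\<Sum>j=1..r. (mellin_deriv ^^ j) f x / (fact j * w ^ j) * Q j (x powr w))" for w
  have S: "S \<in> o[at_top](\<lambda>w. 1 / w ^ r)"
    unfolding S_def Q_def
  proof (rule durrmeyer_op_expansion[OF assms(1,2) moment0])
    show "cont_moment 0 phi = 1" using K1_phi by (simp add: cont_moment_def)
    show "abs_moment r chi < \<infinity>" "abs_cont_moment r phi < \<infinity>"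
      using K2_fin by (auto simp: less_top[symmetric])
  qed (use assms in auto)
  \<comment> \<open>Rescaling \<open>w\<close> by a fixed positive \<open>i\<close> changes the order of magnitude only by the constant \<open>i\<^sup>-\<^sup>r\<close>.\<close>
  have "(\<lambda>w. S (real i * w)) \<in> o[at_top](\<lambda>w. 1 / w ^ r)" if "i \<in> {1..p}" for i
  proof -
    have "filterlim (\<lambda>w. real i * w) at_top at_top"
      using that by (intro filterlim_tendsto_pos_mult_at_top[OF tendsto_const _ filterlim_ident]) auto
    from landau_o.small.compose[OF S this]
    have "(\<lambda>w. S (real i * w)) \<in> o[at_top](\<lambda>w. 1 / (real i * w) ^ r)" .
    also have "(\<lambda>w. 1 / (real i * w) ^ r) = (\<lambda>w. (1 / real i ^ r) * (1 / w ^ r))"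
      by (simp add: power_mult_distrib)
    also have "o[at_top](\<lambda>w. (1 / real i ^ r) * (1 / w ^ r)) = o[at_top](\<lambda>w. 1 / w ^ r)"
      using that by (intro landau_o.small.cmult) simp
    finally show ?thesis .
  qed
  then have "(\<lambda>w. \<Sum>i=1..p. \<beta> i * S (real i * w)) \<in> o[at_top](\<lambda>w. 1 / w ^ r)"
    by (intro big_sum_in_smallo) auto
  \<comment> \<open>As the \<open>\<beta> i\<close> sum to one, the values \<open>f x\<close> recombine; the factors \<open>i\<^sup>-\<^sup>j\<close> come from \<open>(i w)\<^sup>-\<^sup>j\<close>.\<close>
  moreover have "(\<Sum>i=1..p. \<beta> i * S (real i * w)) = durrmeyer_comb chi phi \<beta> p w f x - f x
            - (\<Sum>j=1..r. (mellin_deriv ^^ j) f x / (fact j * w ^ j)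
                 * comb_moment chi phi \<beta> p j (\<lambda>i. x powr (real i * w)))" for w
  proof -
    let ?e = "\<lambda>i j. (mellin_deriv ^^ j) f x / (fact j * w ^ j) *
        (\<beta> i / real i ^ j * Q j (x powr (real i * w)))"
    have "(\<Sum>i=1..p. \<beta> i * S (real i * w)) =
        (\<Sum>i=1..p. \<beta> i * durrmeyer_op chi phi (real i * w) f x - \<beta> i * f x - (\<Sum>j=1..r. ?e i j))"
    proof (rule sum.cong[OF refl])
      fix i
      have "\<beta> i * ((mellin_deriv ^^ j) f x / (fact j * (real i * w) ^ j) * Q j (x powr (real i * w))) = ?e i j" for j
        by (simp add: power_mult_distrib mult_ac)
      then show "\<beta> i * S (real i * w) =
          \<beta> i * durrmeyer_op chi phi (real i * w) f x - \<beta> i * f x - (\<Sum>j=1..r. ?e i j)"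
        by (simp only: S_def right_diff_distrib sum_distrib_left)
    qed
    also have "\<dots> = durrmeyer_comb chi phi \<beta> p w f x - (\<Sum>i=1..p. \<beta> i) * f x - (\<Sum>i=1..p. \<Sum>j=1..r. ?e i j)"
      by (simp only: sum_subtractf durrmeyer_comb_def sum_distrib_right)
    also have "(\<Sum>i=1..p. \<Sum>j=1..r. ?e i j) = (\<Sum>j=1..r. \<Sum>i=1..p. ?e i j)"
      by (rule sum.swap)
    finally show ?thesis
      by (simp only: comb_moment_Q assms(10) mult_1 sum_distrib_left)
  qed
  ultimately have first: "(\<lambda>w. durrmeyer_comb chi phi \<beta> p w f x - f x
            - (\<Sum>j=1..r. (mellin_deriv ^^ j) f x / (fact j * w ^ j)
                 * comb_moment chi phi \<beta> p j (\<lambda>i. x powr (real i * w))))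
          \<in> o[at_top](\<lambda>w. 1 / w ^ r)" (is "?D \<in> _")
    by simp
  have "(\<lambda>w. durrmeyer_comb chi phi \<beta> p w f x - f x
            - (\<Sum>j=1..r. (mellin_deriv ^^ j) f x / (fact j * w ^ j)
                 * comb_moment chi phi \<beta> p j (\<lambda>i. x))) \<in> o[at_top](\<lambda>w. 1 / w ^ r)" (is "?D' \<in> _")
    if const: "\<forall>\<eta>\<in>{1..r}. \<forall>w>0. moment \<eta> chi (x powr w) = moment \<eta> chi x"
  proof -
    \<comment> \<open>Order zero is covered by the normalisation of \<open>chi\<close>, all other orders by the assumption.\<close>
    have same: "moment \<eta> chi (x powr w) = moment \<eta> chi x" if "\<eta> \<le> r" "w > 0" for \<eta> w
      using that const moment0 \<open>x > 0\<close> by (cases "\<eta> = 0") auto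
    have "\<forall>\<^sub>F w in at_top. ?D w = ?D' w"
      using eventually_gt_at_top[of 0]
    proof eventually_elim
      case (elim w)
      have "Q j (x powr (real i * w)) = Q j x" if "i \<in> {1..p}" "j \<in> {1..r}" for i j
        unfolding Q_def using that elim by (intro sum.cong refl) (simp add: same)
      then have "comb_moment chi phi \<beta> p j (\<lambda>i. x powr (real i * w)) = comb_moment chi phi \<beta> p j (\<lambda>i. x)"
        if "j \<in> {1..r}" for j
        unfolding comb_moment_Q using that by (intro sum.cong refl) (simp only:)
      then have "(\<Sum>j=1..r. (mellin_deriv ^^ j) f x / (fact j * w ^ j)
            * comb_moment chi phi \<beta> p j (\<lambda>i. x powr (real i * w))) =
          (\<Sum>j=1..r. (mellin_deriv ^^ j) f x / (fact j * w ^ j) * comb_moment chi phi \<beta> p j (\<lambda>i. x))"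
        by (intro sum.cong refl) (simp only:)
      then show ?case by (simp only:)
    qed
    then show ?thesis by (rule iffD1[OF landau_o.small.in_cong first])
  qed
  with first show ?thesis by (intro conjI impI)
qed

end
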